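(* The logic $\mathsf{GS4^c}$ has the finite birelational frame property (for every formula $\varphi$ of $\mathcal L$, if $\varphi$ is falsifiable, respectively satisfiable, on some $\mathsf{GS4^c}$ frame, then it is falsifiable, respectively satisfiable, on some finite $\mathsf{GS4^c}$ frame), and hence $\mathsf{GS4^c}$ is decidable (membership of a given formula in $\mathsf{GS4^c}$ is decidable).
   Context: Fix a countably infinite set $\mathbb P$ of propositional variables. The language $\mathcal L$: $\varphi ::= p \mid \bot \mid (\varphi\wedge\varphi)\mid(\varphi\vee\varphi)\mid(\varphi\to\varphi)\mid\Diamond\varphi\mid\Box\varphi$, $p\in\mathbb P$; $\neg\varphi:=\varphi\to\bot$. A logic is a set of formulas closed under substitution. $\mathsf{CS4}$ is the smallest logic containing all intuitionistic propositional tautologies (in $\mathcal L$) and the axioms $\Box(p\to q)\to(\Box p\to\Box q)$, $\Box(p\to q)\to(\Diamond p\to\Diamond q)$, $\Box p\to p$, $p\to\Diamond p$, $\Diamond\Diamond p\to\Diamond p$, $\Box p\to\Box\Box p$, and closed under modus ponens and necessitation (from $\varphi$ infer $\Box\varphi$). $\mathsf{GS4^c}$ is the smallest such logic extending $\mathsf{CS4}$ that also contains $\Diamond(p\vee q)\to\Diamond p\vee\Diamond q$, $\neg\Diamond\bot$, $(\Diamond p\to\Box q)\to\Box(p\to q)$, $(p\to q)\vee(q\to p)$ and $\Box(p\vee q)\to\Box p\vee\Diamond q$. A bi-intuitionistic frame $(W,W^\bot,\preccurlyeq,\sqsubseteq)$: $\preccurlyeq,\sqsubseteq$ preorders on $W$,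 $W^\bot\subseteq W$ closed upward under both; infallible if $W^\bot=\varnothing$. Forth--up confluent: $w\preccurlyeq w'$, $w\sqsubseteq v$ imply some $v'$ with $v\preccurlyeq v'$, $w'\sqsubseteq v'$. Back--up confluent: $w\sqsubseteq v\preccurlyeq v'$ implies some $w'$ with $w\preccurlyeq w'\sqsubseteq v'$. Forth--down confluent: $w\preccurlyeq v\sqsubseteq v'$ implies some $w'$ with $w\sqsubseteq w'\preccurlyeq v'$. Upward linear: $w\preccurlyeq u$, $w\preccurlyeq v$ imply $u\preccurlyeq v$ or $v\preccurlyeq u$. A $\mathsf{GS4^c}$ frame is an infallible bi-intuitionistic frame that is forth--up, back--up and forth--down confluent and upward linear. Valuations $V:\mathbb P\to2^W$ have each $V(p)$ $\preccurlyeq$-upward closed and containing $W^\bot$. Satisfaction: $w\models p$ iff $w\in V(p)$; $w\models\bot$ iff $w\in W^\bot$; $\wedge,\vee$ pointwise; $w\models\varphi\to\psi$ iff for all $v\succcurlyeq w$, $v\models\varphi$ implies $v\models\psi$; $w\models\Diamond\varphi$ iff for all $u\succcurlyeq w$ there is $v\sqsupseteq u$ with $v\models\varphi$; $w\models\Box\varphi$ iff for all $u,v$ with $w\preccurlyeq u\sqsubseteq v$, $v\models\varphi$. Falsifiable / satisfiable on a frame: for some valuation, some world outside $W^\bot$ fails / satisfies $\varphi$. *)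

theory Defs
  imports Main "HOL-Library.Nat_Bijection"
begin

section \<open>Formulas\<close>

text \<open>The countably infinite set of propositional variables is \<open>nat\<close>.\<close>

datatype fm =
    Var nat
  | Bot  ("\<^bold>\<bottom>")
  | And fm fm  (infixr "\<^bold>\<and>" 65)
  | Or fm fm   (infixr "\<^bold>\<or>" 60)
  | Imp fm fm  (infixr "\<^bold>\<rightarrow>" 55)
  | Dia fm  ("\<^bold>\<diamond> _" [70] 70)
  | Box fm  ("\<^bold>\<box> _" [70] 70)

abbreviation Neg :: "fm \<Rightarrow> fm"  ("\<^bold>\<not> _" [70] 70) where
  "\<^bold>\<not> \<phi> \<equiv> \<phi> \<^bold>\<rightarrow> \<^bold>\<bottom>"

primrec subst :: "(nat \<Rightarrow> fm) \<Rightarrow> fm \<Rightarrow> fm" where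
  "subst \<sigma> (Var p) = \<sigma> p"
| "subst \<sigma> Bot = Bot"
| "subst \<sigma> (And \<phi> \<psi>) = And (subst \<sigma> \<phi>) (subst \<sigma> \<psi>)"
| "subst \<sigma> (Or \<phi> \<psi>) = Or (subst \<sigma> \<phi>) (subst \<sigma> \<psi>)"
| "subst \<sigma> (Imp \<phi> \<psi>) = Imp (subst \<sigma> \<phi>) (subst \<sigma> \<psi>)"
| "subst \<sigma> (Dia \<phi>) = Dia (subst \<sigma> \<phi>)"
| "subst \<sigma> (Box \<phi>) = Box (subst \<sigma> \<phi>)"


section \<open>The logics \<open>CS4\<close> and \<open>GS4\<^sup>c\<close>\<close>

text \<open>
  Intuitionistic propositional tautologies of the full language, by the usual Hilbert calculus;
  formulas \<open>\<^bold>\<diamond> \<phi>\<close> and \<open>\<^bold>\<box> \<phi>\<close> behave as atoms.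
\<close>

inductive_set int_taut :: "fm set" where
  K: "\<phi> \<^bold>\<rightarrow> \<psi> \<^bold>\<rightarrow> \<phi> \<in> int_taut"
| S: "(\<phi> \<^bold>\<rightarrow> \<psi> \<^bold>\<rightarrow> \<chi>) \<^bold>\<rightarrow> (\<phi> \<^bold>\<rightarrow> \<psi>) \<^bold>\<rightarrow> \<phi> \<^bold>\<rightarrow> \<chi> \<in> int_taut"
| conj1: "\<phi> \<^bold>\<and> \<psi> \<^bold>\<rightarrow> \<phi> \<in> int_taut"
| conj2: "\<phi> \<^bold>\<and> \<psi> \<^bold>\<rightarrow> \<psi> \<in> int_taut"
| conj3: "\<phi> \<^bold>\<rightarrow> \<psi> \<^bold>\<rightarrow> \<phi> \<^bold>\<and> \<psi> \<in> int_taut"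
| disj1: "\<phi> \<^bold>\<rightarrow> \<phi> \<^bold>\<or> \<psi> \<in> int_taut"
| disj2: "\<psi> \<^bold>\<rightarrow> \<phi> \<^bold>\<or> \<psi> \<in> int_taut"
| disj3: "(\<phi> \<^bold>\<rightarrow> \<chi>) \<^bold>\<rightarrow> (\<psi> \<^bold>\<rightarrow> \<chi>) \<^bold>\<rightarrow> \<phi> \<^bold>\<or> \<psi> \<^bold>\<rightarrow> \<chi> \<in> int_taut"
| efq: "\<^bold>\<bottom> \<^bold>\<rightarrow> \<phi> \<in> int_taut"
| mp: "\<phi> \<^bold>\<rightarrow> \<psi> \<in> int_taut \<Longrightarrow> \<phi> \<in> int_taut \<Longrightarrow> \<psi> \<in> int_taut"

inductive_set logic_of :: "fm set \<Rightarrow> fm set" for Ax :: "fm set" where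
  taut: "\<phi> \<in> int_taut \<Longrightarrow> \<phi> \<in> logic_of Ax"
| ax: "\<phi> \<in> Ax \<Longrightarrow> \<phi> \<in> logic_of Ax"
| sub: "\<phi> \<in> logic_of Ax \<Longrightarrow> subst \<sigma> \<phi> \<in> logic_of Ax"
| mp: "\<phi> \<^bold>\<rightarrow> \<psi> \<in> logic_of Ax \<Longrightarrow> \<phi> \<in> logic_of Ax \<Longrightarrow> \<psi> \<in> logic_of Ax"
| nec: "\<phi> \<in> logic_of Ax \<Longrightarrow> \<^bold>\<box> \<phi> \<in> logic_of Ax"

definition CS4 :: "fm set" where
  "CS4 = (let p = Var 0; q = Var 1 in logic_of
     {\<^bold>\<box> (p \<^bold>\<rightarrow> q) \<^bold>\<rightarrow> (\<^bold>\<box> p \<^bold>\<rightarrow> \<^bold>\<box> q),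
      \<^bold>\<box> (p \<^bold>\<rightarrow> q) \<^bold>\<rightarrow> (\<^bold>\<diamond> p \<^bold>\<rightarrow> \<^bold>\<diamond> q),
      \<^bold>\<box> p \<^bold>\<rightarrow> p,
      p \<^bold>\<rightarrow> \<^bold>\<diamond> p,
      \<^bold>\<diamond> \<^bold>\<diamond> p \<^bold>\<rightarrow> \<^bold>\<diamond> p,
      \<^bold>\<box> p \<^bold>\<rightarrow> \<^bold>\<box> \<^bold>\<box> p})"

definition GS4c :: "fm set" where
  "GS4c = (let p = Var 0; q = Var 1 in logic_of (CS4 \<union>
     {\<^bold>\<diamond> (p \<^bold>\<or> q) \<^bold>\<rightarrow> \<^bold>\<diamond> p \<^bold>\<or> \<^bold>\<diamond> q,
      \<^bold>\<not> \<^bold>\<diamond> \<^bold>\<bottom>,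
      (\<^bold>\<diamond> p \<^bold>\<rightarrow> \<^bold>\<box> q) \<^bold>\<rightarrow> \<^bold>\<box> (p \<^bold>\<rightarrow> q),
      (p \<^bold>\<rightarrow> q) \<^bold>\<or> (q \<^bold>\<rightarrow> p),
      \<^bold>\<box> (p \<^bold>\<or> q) \<^bold>\<rightarrow> \<^bold>\<box> p \<^bold>\<or> \<^bold>\<diamond> q}))"


section \<open>Birelational frames\<close>

record 'w frame =
  worlds :: "'w set"
  fallible :: "'w set"
  le :: "'w rel"
  sq :: "'w rel"

definition bi_int_frame :: "'w frame \<Rightarrow> bool" where
  "bi_int_frame F \<longleftrightarrow>
     preorder_on (worlds F) (le F) \<and> preorder_on (worlds F) (sq F) \<and>
     fallible F \<subseteq> worlds F \<and>
     (\<forall>w v. w \<in> fallible F \<longrightarrow> (w, v) \<in> le F \<union> sq F \<longrightarrow> v \<in> fallible F)"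

definition infallible :: "'w frame \<Rightarrow> bool" where
  "infallible F \<longleftrightarrow> fallible F = {}"

definition forth_up_confluent :: "'w frame \<Rightarrow> bool" where
  "forth_up_confluent F \<longleftrightarrow> (\<forall>w w' v. (w, w') \<in> le F \<longrightarrow> (w, v) \<in> sq F \<longrightarrow>
     (\<exists>v'. (v, v') \<in> le F \<and> (w', v') \<in> sq F))"

definition back_up_confluent :: "'w frame \<Rightarrow> bool" where
  "back_up_confluent F \<longleftrightarrow> (\<forall>w v v'. (w, v) \<in> sq F \<longrightarrow> (v, v') \<in> le F \<longrightarrow>
     (\<exists>w'. (w, w') \<in> le F \<and> (w', v') \<in> sq F))"

definition forth_down_confluent :: "'w frame \<Rightarrow> bool" where
  "forth_down_confluent F \<longleftrightarrow> (\<forall>w v v'. (w, v) \<in> le F \<longrightarrow> (v, v') \<in> sq F \<longrightarrow>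
     (\<exists>w'. (w, w') \<in> sq F \<and> (w', v') \<in> le F))"

definition upward_linear :: "'w frame \<Rightarrow> bool" where
  "upward_linear F \<longleftrightarrow> (\<forall>w u v. (w, u) \<in> le F \<longrightarrow> (w, v) \<in> le F \<longrightarrow>
     (u, v) \<in> le F \<or> (v, u) \<in> le F)"

definition GS4c_frame :: "'w frame \<Rightarrow> bool" where
  "GS4c_frame F \<longleftrightarrow> bi_int_frame F \<and> infallible F \<and> forth_up_confluent F \<and>
     back_up_confluent F \<and> forth_down_confluent F \<and> upward_linear F"

definition valuation :: "'w frame \<Rightarrow> (nat \<Rightarrow> 'w set) \<Rightarrow> bool" where
  "valuation F V \<longleftrightarrow> (\<forall>p. V p \<subseteq> worlds F \<and> fallible F \<subseteq> V p \<and>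
     (\<forall>w v. w \<in> V p \<longrightarrow> (w, v) \<in> le F \<longrightarrow> v \<in> V p))"

primrec sat :: "'w frame \<Rightarrow> (nat \<Rightarrow> 'w set) \<Rightarrow> 'w \<Rightarrow> fm \<Rightarrow> bool" where
  "sat F V w (Var p) \<longleftrightarrow> w \<in> V p"
| "sat F V w Bot \<longleftrightarrow> w \<in> fallible F"
| "sat F V w (And \<phi> \<psi>) \<longleftrightarrow> sat F V w \<phi> \<and> sat F V w \<psi>"
| "sat F V w (Or \<phi> \<psi>) \<longleftrightarrow> sat F V w \<phi> \<or> sat F V w \<psi>"
| "sat F V w (Imp \<phi> \<psi>) \<longleftrightarrow> (\<forall>v. (w, v) \<in> le F \<longrightarrow> sat F V v \<phi> \<longrightarrow> sat F V v \<psi>)"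
| "sat F V w (Dia \<phi>) \<longleftrightarrow> (\<forall>u. (w, u) \<in> le F \<longrightarrow> (\<exists>v. (u, v) \<in> sq F \<and> sat F V v \<phi>))"
| "sat F V w (Box \<phi>) \<longleftrightarrow> (\<forall>u v. (w, u) \<in> le F \<longrightarrow> (u, v) \<in> sq F \<longrightarrow> sat F V v \<phi>)"

definition falsifiable_on :: "'w frame \<Rightarrow> fm \<Rightarrow> bool" where
  "falsifiable_on F \<phi> \<longleftrightarrow>
     (\<exists>V. valuation F V \<and> (\<exists>w \<in> worlds F - fallible F. \<not> sat F V w \<phi>))"

definition satisfiable_on :: "'w frame \<Rightarrow> fm \<Rightarrow> bool" where
  "satisfiable_on F \<phi> \<longleftrightarrow>
     (\<exists>V. valuation F V \<and> (\<exists>w \<in> worlds F - fallible F. sat F V w \<phi>))"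


section \<open>Decidability\<close>

text \<open>
  The total recursive functions of arity \<open>n\<close>, as generated by composition, primitive recursion and
  regular minimization. Arguments come as lists; a function of arity \<open>n\<close> is only meaningful on lists
  of length \<open>n\<close>. In \<open>prim_rec\<close> the recursion argument is the first one, and the step function
  receives the counter, the previous value and the parameters.
\<close>

inductive recursive_fun :: "nat \<Rightarrow> (nat list \<Rightarrow> nat) \<Rightarrow> bool" where
  zero: "recursive_fun n (\<lambda>xs. 0)"
| succ: "recursive_fun 1 (\<lambda>xs. Suc (xs ! 0))"
| proj: "i < n \<Longrightarrow> recursive_fun n (\<lambda>xs. xs ! i)"
| comp: "recursive_fun (length gs) f \<Longrightarrow> (\<And>g. g \<in> set gs \<Longrightarrow> recursive_fun n g) \<Longrightarrow>
    recursive_fun n (\<lambda>xs. f (map (\<lambda>g. g xs) gs))"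
| prim_rec: "recursive_fun n f \<Longrightarrow> recursive_fun (Suc (Suc n)) g \<Longrightarrow>
    recursive_fun (Suc n) (\<lambda>xs. rec_nat (f (tl xs)) (\<lambda>y r. g (y # r # tl xs)) (hd xs))"
| minim: "recursive_fun (Suc n) f \<Longrightarrow> (\<And>xs. length xs = n \<Longrightarrow> \<exists>y. f (y # xs) = 0) \<Longrightarrow>
    recursive_fun n (\<lambda>xs. LEAST y. f (y # xs) = 0)"

primrec fm_code :: "fm \<Rightarrow> nat" where
  "fm_code (Var p) = prod_encode (0, p)"
| "fm_code Bot = prod_encode (1, 0)"
| "fm_code (And \<phi> \<psi>) = prod_encode (2, prod_encode (fm_code \<phi>, fm_code \<psi>))"
| "fm_code (Or \<phi> \<psi>) = prod_encode (3, prod_encode (fm_code \<phi>, fm_code \<psi>))"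
| "fm_code (Imp \<phi> \<psi>) = prod_encode (4, prod_encode (fm_code \<phi>, fm_code \<psi>))"
| "fm_code (Dia \<phi>) = prod_encode (5, fm_code \<phi>)"
| "fm_code (Box \<phi>) = prod_encode (6, fm_code \<phi>)"

lemma inj_fm_code: "inj fm_code"
proof (rule injI)
  fix \<phi> \<psi> show "fm_code \<phi> = fm_code \<psi> \<Longrightarrow> \<phi> = \<psi>"
    by (induction \<phi> arbitrary: \<psi>; case_tac \<psi>; simp)
qed

definition decidable :: "fm set \<Rightarrow> bool" where
  "decidable A \<longleftrightarrow>
     (\<exists>f. recursive_fun 1 f \<and> (\<forall>\<phi>. f [fm_code \<phi>] = (if \<phi> \<in> A then 1 else 0)))"

end

theory Submission
  imports Defs
begin

text \<open>
  In the canonical model the worlds are prime theories ordered by inclusion, and \<open>w \<sqsubseteq> v\<close> means that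
  \<open>\<^bold>\<box> \<phi> \<in> w\<close> implies \<open>\<phi> \<in> v\<close> and \<open>\<phi> \<in> v\<close> implies \<open>\<^bold>\<diamond> \<phi> \<in> w\<close>. It is upward linear but not downward
  linear, so identifying worlds by the types above them would destroy forth-down confluence.
  Therefore worlds are replaced by pairs \<open>(r, w)\<close> with a root \<open>r \<subseteq> w\<close>: the order fixes the root, so that
  its components are chains, and \<open>(r, w) \<sqsubseteq> (s, v)\<close> iff \<open>r \<sqsubseteq> s\<close> and \<open>w \<sqsubseteq> v\<close>. Forth-down confluence
  survives by an interpolation property of the canonical relation. Now \<open>(r, w)\<close> can be identified
  with its type together with the set of all types above \<open>r\<close>, types being taken with respect to the
  subformulas of the given formula; the accessibility relation is the transitive closure of the
  image.

  The quotient has computably bounded size, so non-theoremhood is the existence of a number below a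
  computable bound that codes a countermodel together with its truth relation, and this is a formula
  with bounded quantifiers only.
\<close>

section \<open>Soundness\<close>

text \<open>The types above a world do not determine what lies below it, while forth-down confluence
  asks for representatives to be moved downwards. Fixing a root cures this: the component of
  \<open>(r, w)\<close> is a chain that lies entirely above \<open>r\<close>, and two members of a
  chain with different types are ordered as their types are. Hence the set of types above
  \<open>r\<close>, together with the type of \<open>w\<close>, determines the neighbours of a point
  in both directions.

  The axioms added to \<open>CS4\<close> each have a task. \<open>dia_Or\<close> and
  \<open>dia_Bot\<close> make the complement of \<open>undia w\<close> a set that prime theories can
  avoid; \<open>dia_box_Imp\<close> gives back-up confluence; \<open>linearity\<close> gives the
  chains; \<open>box_Or\<close> gives forth-down confluence and the worlds that refute a box.

  The finite frames are quotients of the canonical model, not of the frame in which a formula was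
  falsified or satisfied.\<close>

lemma GS4c_frame_simps:
  assumes "GS4c_frame F"
  shows "fallible F = {}"
    and "w \<in> worlds F \<Longrightarrow> (w, w) \<in> le F"
    and "w \<in> worlds F \<Longrightarrow> (w, w) \<in> sq F"
    and "(w, v) \<in> le F \<Longrightarrow> w \<in> worlds F \<and> v \<in> worlds F"
    and "(w, v) \<in> sq F \<Longrightarrow> w \<in> worlds F \<and> v \<in> worlds F"
    and "(w, v) \<in> le F \<Longrightarrow> (v, u) \<in> le F \<Longrightarrow> (w, u) \<in> le F"
    and "(w, v) \<in> sq F \<Longrightarrow> (v, u) \<in> sq F \<Longrightarrow> (w, u) \<in> sq F"
proof -
  have F: "preorder_on (worlds F) (le F)" "preorder_on (worlds F) (sq F)" "fallible F = {}"
    using assms unfolding GS4c_frame_def bi_int_frame_def infallible_def by auto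
  show "fallible F = {}" by (rule F(3))
  show "(w, w) \<in> le F" "(w, w) \<in> sq F" if "w \<in> worlds F"
    using F that unfolding preorder_on_def refl_on_def by auto
  show "w \<in> worlds F \<and> v \<in> worlds F" if "(w, v) \<in> le F"
    using F(1) that unfolding preorder_on_def by auto
  show "w \<in> worlds F \<and> v \<in> worlds F" if "(w, v) \<in> sq F"
    using F(2) that unfolding preorder_on_def by auto
  show "(w, u) \<in> le F" if "(w, v) \<in> le F" "(v, u) \<in> le F"
    using F(1) that unfolding preorder_on_def by (metis transD)
  show "(w, u) \<in> sq F" if "(w, v) \<in> sq F" "(v, u) \<in> sq F"
    using F(2) that unfolding preorder_on_def by (metis transD)
qed

lemma sat_mono:
  assumes F: "GS4c_frame F" and V: "valuation F V"
  shows "sat F V w \<phi> \<Longrightarrow> (w, v) \<in> le F \<Longrightarrow> sat F V v \<phi>"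
proof (induction \<phi> arbitrary: w v)
  case (Var p)
  then show ?case using V unfolding valuation_def sat.simps by blast
next
  case (Imp \<phi> \<psi>)
  show ?case using Imp.prems GS4c_frame_simps(6)[OF F] unfolding sat.simps by blast
next
  case (Dia \<phi>)
  show ?case using Dia.prems GS4c_frame_simps(6)[OF F] unfolding sat.simps by blast
next
  case (Box \<phi>)
  show ?case using Box.prems GS4c_frame_simps(6)[OF F] unfolding sat.simps by blast
next
  case (And \<phi> \<psi>)
  show ?case using And.prems And.IH unfolding sat.simps by blast
next
  case (Or \<phi> \<psi>)
  show ?case using Or.prems Or.IH unfolding sat.simps by blast
qed (simp add: GS4c_frame_simps(1)[OF F])

text \<open>Forth-up confluence carries a witness found from \<open>w\<close> to every world above
  \<open>w\<close>, so the outer quantifier of the clause collapses. With \<open>sat_Box_iff\<close>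
  both modalities become local.\<close>

lemma sat_Dia_iff:
  assumes F: "GS4c_frame F" and V: "valuation F V" and w: "w \<in> worlds F"
  shows "sat F V w (\<^bold>\<diamond> \<phi>) \<longleftrightarrow> (\<exists>v. (w, v) \<in> sq F \<and> sat F V v \<phi>)"
proof
  show "sat F V w (\<^bold>\<diamond> \<phi>) \<Longrightarrow> \<exists>v. (w, v) \<in> sq F \<and> sat F V v \<phi>"
    using GS4c_frame_simps(2)[OF F w] by auto
  have "forth_up_confluent F" using F by (simp add: GS4c_frame_def)
  then show "\<exists>v. (w, v) \<in> sq F \<and> sat F V v \<phi> \<Longrightarrow> sat F V w (\<^bold>\<diamond> \<phi>)"
    using sat_mono[OF F V] unfolding forth_up_confluent_def sat.simps by blast
qed

text \<open>By forth-down confluence, a world reached after a step up lies above one reached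
  directly, and truth persists upwards.\<close>

lemma sat_Box_iff:
  assumes F: "GS4c_frame F" and V: "valuation F V" and w: "w \<in> worlds F"
  shows "sat F V w (\<^bold>\<box> \<phi>) \<longleftrightarrow> (\<forall>v. (w, v) \<in> sq F \<longrightarrow> sat F V v \<phi>)"
proof
  show "sat F V w (\<^bold>\<box> \<phi>) \<Longrightarrow> \<forall>v. (w, v) \<in> sq F \<longrightarrow> sat F V v \<phi>"
    using GS4c_frame_simps(2)[OF F w] by auto
  have "forth_down_confluent F" using F by (simp add: GS4c_frame_def)
  then show "\<forall>v. (w, v) \<in> sq F \<longrightarrow> sat F V v \<phi> \<Longrightarrow> sat F V w (\<^bold>\<box> \<phi>)"
    using sat_mono[OF F V] unfolding forth_down_confluent_def sat.simps by blast
qed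

lemma valuation_subst:
  assumes F: "GS4c_frame F" and V: "valuation F V"
  shows "valuation F (\<lambda>p. {w \<in> worlds F. sat F V w (\<sigma> p)})"
  unfolding valuation_def GS4c_frame_simps(1)[OF F]
  using sat_mono[OF F V] GS4c_frame_simps(4)[OF F] by simp blast

lemma sat_subst:
  assumes F: "GS4c_frame F"
  shows "w \<in> worlds F \<Longrightarrow>
    sat F V w (subst \<sigma> \<phi>) \<longleftrightarrow> sat F (\<lambda>p. {w \<in> worlds F. sat F V w (\<sigma> p)}) w \<phi>"
proof (induction \<phi> arbitrary: w)
  case (Imp \<phi> \<psi>)
  have "v \<in> worlds F" if "(w, v) \<in> le F" for v
    using GS4c_frame_simps(4)[OF F that] by simp
  with Imp show ?case by simp
next
  case (Dia \<phi>)
  have "v \<in> worlds F" if "(u, v) \<in> sq F" for u v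
    using GS4c_frame_simps(5)[OF F that] by simp
  with Dia show ?case by (simp cong: conj_cong)
next
  case (Box \<phi>)
  have "v \<in> worlds F" if "(u, v) \<in> sq F" for u v
    using GS4c_frame_simps(5)[OF F that] by simp
  with Box show ?case by simp
qed simp_all

text \<open>The quantifier over valuations is what survives the substitution rule: substituting into
  a formula amounts to changing the valuation.\<close>

definition valid :: "'w frame \<Rightarrow> fm \<Rightarrow> bool" where
  "valid F \<phi> \<longleftrightarrow> (\<forall>V w. valuation F V \<longrightarrow> w \<in> worlds F \<longrightarrow> sat F V w \<phi>)"

lemma sat_Imp_self: "GS4c_frame F \<Longrightarrow> w \<in> worlds F \<Longrightarrow> sat F V w (\<phi> \<^bold>\<rightarrow> \<psi>) \<Longrightarrow>
    sat F V w \<phi> \<Longrightarrow> sat F V w \<psi>"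
  using GS4c_frame_simps(2) by fastforce

lemma valid_int_taut:
  assumes F: "GS4c_frame F"
  shows "\<phi> \<in> int_taut \<Longrightarrow> valid F \<phi>"
proof (induction rule: int_taut.induct)
  case (S \<phi> \<psi> \<chi>)
  then show ?case
    using GS4c_frame_simps(2,4,6)[OF F] unfolding valid_def sat.simps by meson
next
  case (disj3 \<phi> \<chi> \<psi>)
  then show ?case
    using GS4c_frame_simps(6)[OF F] unfolding valid_def sat.simps by meson
next
  case (mp \<phi> \<psi>)
  then show ?case
    using sat_Imp_self[OF F] unfolding valid_def by blast
next
  case (efq \<phi>)
  then show ?case
    using GS4c_frame_simps(1)[OF F] unfolding valid_def by simp
qed (use sat_mono[OF F] GS4c_frame_simps(4)[OF F] in \<open>auto simp: valid_def\<close>)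

lemma valid_logic_of:
  assumes F: "GS4c_frame F" and Ax: "\<And>\<phi>. \<phi> \<in> Ax \<Longrightarrow> valid F \<phi>"
  shows "\<phi> \<in> logic_of Ax \<Longrightarrow> valid F \<phi>"
proof (induction rule: logic_of.induct)
  case (taut \<phi>)
  then show ?case by (rule valid_int_taut[OF F])
next
  case (ax \<phi>)
  then show ?case by (rule Ax)
next
  case (sub \<phi> \<sigma>)
  then show ?case
    using valuation_subst[OF F] sat_subst[OF F] unfolding valid_def by blast
next
  case (mp \<phi> \<psi>)
  then show ?case
    using sat_Imp_self[OF F] unfolding valid_def by blast
next
  case (nec \<phi>)
  then show ?case
    using GS4c_frame_simps(5)[OF F] unfolding valid_def sat.simps by blast
qed

lemma valid_Imp:
  assumes F: "GS4c_frame F"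
    and "\<And>V w. valuation F V \<Longrightarrow> w \<in> worlds F \<Longrightarrow> sat F V w \<phi> \<Longrightarrow> sat F V w \<psi>"
  shows "valid F (\<phi> \<^bold>\<rightarrow> \<psi>)"
  using assms(2) GS4c_frame_simps(4)[OF F] by (auto simp: valid_def)

lemma valid_CS4:
  assumes F: "GS4c_frame F" and "\<phi> \<in> CS4"
  shows "valid F \<phi>"
proof -
  note d = sat_Dia_iff[OF F] and b = sat_Box_iff[OF F]
    and fr = GS4c_frame_simps[OF F]
  let ?p = "Var 0" and ?q = "Var 1"
  have 1: "valid F (\<^bold>\<box> (?p \<^bold>\<rightarrow> ?q) \<^bold>\<rightarrow> (\<^bold>\<box> ?p \<^bold>\<rightarrow> \<^bold>\<box> ?q))"
    by (rule valid_Imp[OF F]) (use fr(2,4,5,6) in \<open>unfold sat.simps, meson\<close>)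
  have 2: "valid F (\<^bold>\<box> (?p \<^bold>\<rightarrow> ?q) \<^bold>\<rightarrow> (\<^bold>\<diamond> ?p \<^bold>\<rightarrow> \<^bold>\<diamond> ?q))"
    by (rule valid_Imp[OF F]) (use fr(2,4,5,6) in \<open>unfold sat.simps, meson\<close>)
  have 3: "valid F (\<^bold>\<box> ?p \<^bold>\<rightarrow> ?p)"
    by (rule valid_Imp[OF F]) (use fr(3) b in blast)
  have 4: "valid F (?p \<^bold>\<rightarrow> \<^bold>\<diamond> ?p)"
    by (rule valid_Imp[OF F]) (use fr(3) d in blast)
  have 5: "valid F (\<^bold>\<diamond> \<^bold>\<diamond> ?p \<^bold>\<rightarrow> \<^bold>\<diamond> ?p)"
    by (rule valid_Imp[OF F]) (use fr(5,7) d in \<open>simp only:, meson\<close>)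
  have 6: "valid F (\<^bold>\<box> ?p \<^bold>\<rightarrow> \<^bold>\<box> \<^bold>\<box> ?p)"
    by (rule valid_Imp[OF F]) (metis fr(5,7) b)
  show ?thesis
    using \<open>\<phi> \<in> CS4\<close> unfolding CS4_def Let_def
    by (rule valid_logic_of[OF F, rotated]) (elim insertE emptyE; simp only: 1 2 3 4 5 6)
qed

theorem GS4c_sound:
  assumes F: "GS4c_frame F" and "\<phi> \<in> GS4c"
  shows "valid F \<phi>"
proof -
  note d = sat_Dia_iff[OF F] and b = sat_Box_iff[OF F] and m = sat_mono[OF F]
    and fr = GS4c_frame_simps[OF F]
  have bu: "back_up_confluent F" and ul: "upward_linear F"
    using F by (auto simp: GS4c_frame_def)
  let ?p = "Var 0" and ?q = "Var 1"
  have 1: "valid F (\<^bold>\<diamond> (?p \<^bold>\<or> ?q) \<^bold>\<rightarrow> \<^bold>\<diamond> ?p \<^bold>\<or> \<^bold>\<diamond> ?q)"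
    by (rule valid_Imp[OF F]) (simp only: d sat.simps(4), blast)
  have 2: "valid F (\<^bold>\<not> \<^bold>\<diamond> \<^bold>\<bottom>)"
    by (rule valid_Imp[OF F]) (use fr(1-3) in \<open>unfold sat.simps, metis empty_iff\<close>)
  have 3: "valid F ((\<^bold>\<diamond> ?p \<^bold>\<rightarrow> \<^bold>\<box> ?q) \<^bold>\<rightarrow> \<^bold>\<box> (?p \<^bold>\<rightarrow> ?q))"
  proof (rule valid_Imp[OF F])
    fix V w assume V: "valuation F V" and w: "w \<in> worlds F"
      and h: "sat F V w (\<^bold>\<diamond> ?p \<^bold>\<rightarrow> \<^bold>\<box> ?q)"
    have "sat F V v' ?q" if wv: "(w, v) \<in> sq F" "(v, v') \<in> le F" and v': "sat F V v' ?p" for v v'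
    proof -
      \<comment> \<open>The hypothesis speaks about worlds above \<open>w\<close>, but
        \<open>v'\<close> lies above \<open>v\<close>; back-up confluence yields a world above
        \<open>w\<close> that sees \<open>v'\<close>.\<close>
      obtain w' where "(w, w') \<in> le F" "(w', v') \<in> sq F"
        using bu wv unfolding back_up_confluent_def by blast
      moreover from this have "sat F V w' (\<^bold>\<diamond> ?p)"
        using d[OF V] fr(4) v' by blast
      ultimately have "sat F V w' (\<^bold>\<box> ?q)"
        using h by (metis sat.simps(5))
      then show ?thesis
        using b[OF V] fr(4) \<open>(w, w') \<in> le F\<close> \<open>(w', v') \<in> sq F\<close> by blast
    qed
    then show "sat F V w (\<^bold>\<box> (?p \<^bold>\<rightarrow> ?q))"
      using b[OF V w] by (metis sat.simps(5))
  qed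
  \<comment> \<open>Two worlds above \<open>w\<close> refuting the two implications are comparable,
    and by persistence both variables would hold at the upper one.\<close>
  have 4: "valid F ((?p \<^bold>\<rightarrow> ?q) \<^bold>\<or> (?q \<^bold>\<rightarrow> ?p))"
    using ul m[where \<phi> = ?p] m[where \<phi> = ?q] unfolding valid_def upward_linear_def sat.simps
    by blast
  have 5: "valid F (\<^bold>\<box> (?p \<^bold>\<or> ?q) \<^bold>\<rightarrow> \<^bold>\<box> ?p \<^bold>\<or> \<^bold>\<diamond> ?q)"
    by (rule valid_Imp[OF F]) (simp only: b d sat.simps(4), blast)
  show ?thesis
    using \<open>\<phi> \<in> GS4c\<close> unfolding GS4c_def Let_def
    by (rule valid_logic_of[OF F, rotated]) (elim UnE insertE emptyE; simp only: 1 2 3 4 5 valid_CS4[OF F])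
qed

text \<open>Reduces the satisfiability half of the finite frame property to the other half. The two
  worlds may differ: a refuted negation only yields a satisfying world further up.\<close>

lemma satisfiable_iff_falsifiable_Neg:
  assumes F: "GS4c_frame F"
  shows "satisfiable_on F \<phi> \<longleftrightarrow> falsifiable_on F (\<^bold>\<not> \<phi>)"
proof -
  note fr = GS4c_frame_simps[OF F]
  have "(\<exists>w\<in>worlds F. sat F V w \<phi>) \<longleftrightarrow> (\<exists>w\<in>worlds F. \<not> sat F V w (\<^bold>\<not> \<phi>))" for V
    unfolding sat.simps fr(1) using fr(2,4) by blast
  then show ?thesis
    unfolding satisfiable_on_def falsifiable_on_def fr(1) by simp
qed

lemma falsifiable_not_GS4c: "GS4c_frame F \<Longrightarrow> falsifiable_on F \<phi> \<Longrightarrow> \<phi> \<notin> GS4c"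
  using GS4c_sound unfolding falsifiable_on_def valid_def by blast

section \<open>Prime theories\<close>

lemma GS4c_taut: "\<phi> \<in> int_taut \<Longrightarrow> \<phi> \<in> GS4c"
  and GS4c_mp: "\<phi> \<^bold>\<rightarrow> \<psi> \<in> GS4c \<Longrightarrow> \<phi> \<in> GS4c \<Longrightarrow> \<psi> \<in> GS4c"
  and GS4c_nec: "\<phi> \<in> GS4c \<Longrightarrow> \<^bold>\<box> \<phi> \<in> GS4c"
  and GS4c_subst: "\<phi> \<in> GS4c \<Longrightarrow> subst \<sigma> \<phi> \<in> GS4c"
  unfolding GS4c_def Let_def
  by (blast intro: logic_of.intros)+

lemma CS4_subset_GS4c: "CS4 \<subseteq> GS4c"
  unfolding GS4c_def Let_def by (blast intro: logic_of.ax)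

lemma GS4c_axioms:
  shows box_K: "\<^bold>\<box> (a \<^bold>\<rightarrow> b) \<^bold>\<rightarrow> \<^bold>\<box> a \<^bold>\<rightarrow> \<^bold>\<box> b \<in> GS4c"
    and dia_K: "\<^bold>\<box> (a \<^bold>\<rightarrow> b) \<^bold>\<rightarrow> \<^bold>\<diamond> a \<^bold>\<rightarrow> \<^bold>\<diamond> b \<in> GS4c"
    and box_T: "\<^bold>\<box> a \<^bold>\<rightarrow> a \<in> GS4c"
    and dia_T: "a \<^bold>\<rightarrow> \<^bold>\<diamond> a \<in> GS4c"
    and dia_4: "\<^bold>\<diamond> \<^bold>\<diamond> a \<^bold>\<rightarrow> \<^bold>\<diamond> a \<in> GS4c"
    and box_4: "\<^bold>\<box> a \<^bold>\<rightarrow> \<^bold>\<box> \<^bold>\<box> a \<in> GS4c"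
    and dia_Or: "\<^bold>\<diamond> (a \<^bold>\<or> b) \<^bold>\<rightarrow> \<^bold>\<diamond> a \<^bold>\<or> \<^bold>\<diamond> b \<in> GS4c"
    and dia_Bot: "\<^bold>\<not> \<^bold>\<diamond> \<^bold>\<bottom> \<in> GS4c"
    and dia_box_Imp: "(\<^bold>\<diamond> a \<^bold>\<rightarrow> \<^bold>\<box> b) \<^bold>\<rightarrow> \<^bold>\<box> (a \<^bold>\<rightarrow> b) \<in> GS4c"
    and linearity: "(a \<^bold>\<rightarrow> b) \<^bold>\<or> (b \<^bold>\<rightarrow> a) \<in> GS4c"
    and box_Or: "\<^bold>\<box> (a \<^bold>\<or> b) \<^bold>\<rightarrow> \<^bold>\<box> a \<^bold>\<or> \<^bold>\<diamond> b \<in> GS4c"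
proof -
  let ?p = "Var 0" and ?q = "Var 1" and ?\<sigma> = "\<lambda>n :: nat. if n = 0 then a else b"
  have C: "{\<^bold>\<box> (?p \<^bold>\<rightarrow> ?q) \<^bold>\<rightarrow> (\<^bold>\<box> ?p \<^bold>\<rightarrow> \<^bold>\<box> ?q), \<^bold>\<box> (?p \<^bold>\<rightarrow> ?q) \<^bold>\<rightarrow> (\<^bold>\<diamond> ?p \<^bold>\<rightarrow> \<^bold>\<diamond> ?q),
      \<^bold>\<box> ?p \<^bold>\<rightarrow> ?p, ?p \<^bold>\<rightarrow> \<^bold>\<diamond> ?p, \<^bold>\<diamond> \<^bold>\<diamond> ?p \<^bold>\<rightarrow> \<^bold>\<diamond> ?p, \<^bold>\<box> ?p \<^bold>\<rightarrow> \<^bold>\<box> \<^bold>\<box> ?p} \<subseteq> CS4"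
    unfolding CS4_def Let_def by (rule subsetI) (rule logic_of.ax)
  have G: "{\<^bold>\<diamond> (?p \<^bold>\<or> ?q) \<^bold>\<rightarrow> \<^bold>\<diamond> ?p \<^bold>\<or> \<^bold>\<diamond> ?q, \<^bold>\<not> \<^bold>\<diamond> \<^bold>\<bottom>,
      (\<^bold>\<diamond> ?p \<^bold>\<rightarrow> \<^bold>\<box> ?q) \<^bold>\<rightarrow> \<^bold>\<box> (?p \<^bold>\<rightarrow> ?q), (?p \<^bold>\<rightarrow> ?q) \<^bold>\<or> (?q \<^bold>\<rightarrow> ?p),
      \<^bold>\<box> (?p \<^bold>\<or> ?q) \<^bold>\<rightarrow> \<^bold>\<box> ?p \<^bold>\<or> \<^bold>\<diamond> ?q} \<subseteq> GS4c"
    unfolding GS4c_def Let_def by (rule subsetI, rule logic_of.ax) blast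
  have s: "\<psi> \<in> GS4c" if "\<phi> \<in> GS4c" "\<psi> = subst ?\<sigma> \<phi>" for \<phi> \<psi>
    using GS4c_subst that by simp
  have C': "\<phi> \<in> GS4c" if "\<phi> \<in> CS4" for \<phi>
    using that CS4_subset_GS4c by blast
  show "\<^bold>\<box> (a \<^bold>\<rightarrow> b) \<^bold>\<rightarrow> \<^bold>\<box> a \<^bold>\<rightarrow> \<^bold>\<box> b \<in> GS4c"
    by (rule s[of "\<^bold>\<box> (?p \<^bold>\<rightarrow> ?q) \<^bold>\<rightarrow> (\<^bold>\<box> ?p \<^bold>\<rightarrow> \<^bold>\<box> ?q)"]) (use C C' in auto)
  show "\<^bold>\<box> (a \<^bold>\<rightarrow> b) \<^bold>\<rightarrow> \<^bold>\<diamond> a \<^bold>\<rightarrow> \<^bold>\<diamond> b \<in> GS4c"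
    by (rule s[of "\<^bold>\<box> (?p \<^bold>\<rightarrow> ?q) \<^bold>\<rightarrow> (\<^bold>\<diamond> ?p \<^bold>\<rightarrow> \<^bold>\<diamond> ?q)"]) (use C C' in auto)
  show "\<^bold>\<box> a \<^bold>\<rightarrow> a \<in> GS4c"
    by (rule s[of "\<^bold>\<box> ?p \<^bold>\<rightarrow> ?p"]) (use C C' in auto)
  show "a \<^bold>\<rightarrow> \<^bold>\<diamond> a \<in> GS4c"
    by (rule s[of "?p \<^bold>\<rightarrow> \<^bold>\<diamond> ?p"]) (use C C' in auto)
  show "\<^bold>\<diamond> \<^bold>\<diamond> a \<^bold>\<rightarrow> \<^bold>\<diamond> a \<in> GS4c"
    by (rule s[of "\<^bold>\<diamond> \<^bold>\<diamond> ?p \<^bold>\<rightarrow> \<^bold>\<diamond> ?p"]) (use C C' in auto)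
  show "\<^bold>\<box> a \<^bold>\<rightarrow> \<^bold>\<box> \<^bold>\<box> a \<in> GS4c"
    by (rule s[of "\<^bold>\<box> ?p \<^bold>\<rightarrow> \<^bold>\<box> \<^bold>\<box> ?p"]) (use C C' in auto)
  show "\<^bold>\<diamond> (a \<^bold>\<or> b) \<^bold>\<rightarrow> \<^bold>\<diamond> a \<^bold>\<or> \<^bold>\<diamond> b \<in> GS4c"
    by (rule s[of "\<^bold>\<diamond> (?p \<^bold>\<or> ?q) \<^bold>\<rightarrow> \<^bold>\<diamond> ?p \<^bold>\<or> \<^bold>\<diamond> ?q"]) (use G in auto)
  show "\<^bold>\<not> \<^bold>\<diamond> \<^bold>\<bottom> \<in> GS4c"
    using G by simp
  show "(\<^bold>\<diamond> a \<^bold>\<rightarrow> \<^bold>\<box> b) \<^bold>\<rightarrow> \<^bold>\<box> (a \<^bold>\<rightarrow> b) \<in> GS4c"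
    by (rule s[of "(\<^bold>\<diamond> ?p \<^bold>\<rightarrow> \<^bold>\<box> ?q) \<^bold>\<rightarrow> \<^bold>\<box> (?p \<^bold>\<rightarrow> ?q)"]) (use G in auto)
  show "(a \<^bold>\<rightarrow> b) \<^bold>\<or> (b \<^bold>\<rightarrow> a) \<in> GS4c"
    by (rule s[of "(?p \<^bold>\<rightarrow> ?q) \<^bold>\<or> (?q \<^bold>\<rightarrow> ?p)"]) (use G in auto)
  show "\<^bold>\<box> (a \<^bold>\<or> b) \<^bold>\<rightarrow> \<^bold>\<box> a \<^bold>\<or> \<^bold>\<diamond> b \<in> GS4c"
    by (rule s[of "\<^bold>\<box> (?p \<^bold>\<or> ?q) \<^bold>\<rightarrow> \<^bold>\<box> ?p \<^bold>\<or> \<^bold>\<diamond> ?q"]) (use G in auto)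
qed

text \<open>Necessitation is deliberately left out: it is sound for theorems only, and without it
  the deduction theorem \<open>thy_ImpI\<close> holds.\<close>

definition thy :: "fm set \<Rightarrow> bool" where
  "thy T \<longleftrightarrow> GS4c \<subseteq> T \<and> (\<forall>\<phi> \<psi>. \<phi> \<^bold>\<rightarrow> \<psi> \<in> T \<longrightarrow> \<phi> \<in> T \<longrightarrow> \<psi> \<in> T)"

lemma thy_GS4c: "thy GS4c"
  using GS4c_mp by (auto simp: thy_def)

lemma thy_theorem: "thy T \<Longrightarrow> \<phi> \<in> GS4c \<Longrightarrow> \<phi> \<in> T"
  by (auto simp: thy_def)

lemma thy_mp: "thy T \<Longrightarrow> \<phi> \<^bold>\<rightarrow> \<psi> \<in> T \<Longrightarrow> \<phi> \<in> T \<Longrightarrow> \<psi> \<in> T"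
  by (auto simp: thy_def)

lemma thy_imp: "thy T \<Longrightarrow> \<phi> \<^bold>\<rightarrow> \<psi> \<in> GS4c \<Longrightarrow> \<phi> \<in> T \<Longrightarrow> \<psi> \<in> T"
  using thy_mp thy_theorem by blast

lemma thy_imp2: "thy T \<Longrightarrow> \<phi> \<^bold>\<rightarrow> \<psi> \<^bold>\<rightarrow> \<chi> \<in> GS4c \<Longrightarrow> \<phi> \<in> T \<Longrightarrow> \<psi> \<in> T \<Longrightarrow> \<chi> \<in> T"
  using thy_mp thy_imp by blast

text \<open>The theory generated by \<open>T\<close> and \<open>\<phi>\<close>, with the deduction
  theorem built into the definition.\<close>

definition ext :: "fm set \<Rightarrow> fm \<Rightarrow> fm set" where
  "ext T \<phi> = {\<psi>. \<phi> \<^bold>\<rightarrow> \<psi> \<in> T}"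

lemma thy_weaken: "thy T \<Longrightarrow> \<psi> \<in> T \<Longrightarrow> \<phi> \<^bold>\<rightarrow> \<psi> \<in> T"
  using thy_imp[OF _ GS4c_taut[OF int_taut.K]] by blast

lemma Imp_refl: "\<phi> \<^bold>\<rightarrow> \<phi> \<in> int_taut"
  using int_taut.mp[OF int_taut.mp[OF int_taut.S[of \<phi> "\<phi> \<^bold>\<rightarrow> \<phi>" \<phi>] int_taut.K] int_taut.K] .

lemma thy_ext: assumes T: "thy T" shows "thy (ext T \<phi>)"
  unfolding thy_def
proof (intro conjI allI impI subsetI)
  show "\<psi> \<in> ext T \<phi>" if "\<psi> \<in> GS4c" for \<psi>
    using that T thy_theorem thy_weaken by (auto simp: ext_def)
  show "\<chi> \<in> ext T \<phi>" if "\<psi> \<^bold>\<rightarrow> \<chi> \<in> ext T \<phi>" "\<psi> \<in> ext T \<phi>" for \<psi> \<chi>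
    using that thy_imp2[OF T GS4c_taut[OF int_taut.S]] by (auto simp: ext_def)
qed

lemma ext_subset: "thy T \<Longrightarrow> T \<subseteq> ext T \<phi>"
  using thy_weaken by (auto simp: ext_def)

lemma ext_self: "thy T \<Longrightarrow> \<phi> \<in> ext T \<phi>"
  using thy_theorem GS4c_taut Imp_refl by (auto simp: ext_def)

text \<open>Takes the place of Hilbert-style derivations: one reasons inside an arbitrary larger
  theory containing the antecedent, and \<open>ext T \<phi>\<close> is the instance that
  counts.\<close>

lemma thy_ImpI:
  assumes "thy T" and "\<And>U. thy U \<Longrightarrow> T \<subseteq> U \<Longrightarrow> \<phi> \<in> U \<Longrightarrow> \<psi> \<in> U"
  shows "\<phi> \<^bold>\<rightarrow> \<psi> \<in> T"
  using assms(2)[OF thy_ext[OF assms(1)] ext_subset ext_self] assms(1) by (auto simp: ext_def)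

lemma GS4c_ImpI: "(\<And>U. thy U \<Longrightarrow> \<phi> \<in> U \<Longrightarrow> \<psi> \<in> U) \<Longrightarrow> \<phi> \<^bold>\<rightarrow> \<psi> \<in> GS4c"
  using thy_ImpI[OF thy_GS4c] by blast

lemma thy_And: "thy T \<Longrightarrow> \<phi> \<^bold>\<and> \<psi> \<in> T \<longleftrightarrow> \<phi> \<in> T \<and> \<psi> \<in> T"
  using thy_imp[OF _ GS4c_taut[OF int_taut.conj1]] thy_imp[OF _ GS4c_taut[OF int_taut.conj2]]
    thy_imp2[OF _ GS4c_taut[OF int_taut.conj3]] by blast

lemma thy_OrI: "thy T \<Longrightarrow> \<phi> \<in> T \<or> \<psi> \<in> T \<Longrightarrow> \<phi> \<^bold>\<or> \<psi> \<in> T"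
  using thy_imp[OF _ GS4c_taut[OF int_taut.disj1]] thy_imp[OF _ GS4c_taut[OF int_taut.disj2]]
  by blast

lemma thy_OrE: "thy T \<Longrightarrow> \<phi> \<^bold>\<or> \<psi> \<in> T \<Longrightarrow> \<phi> \<^bold>\<rightarrow> \<chi> \<in> T \<Longrightarrow> \<psi> \<^bold>\<rightarrow> \<chi> \<in> T \<Longrightarrow> \<chi> \<in> T"
  using thy_imp2[OF _ GS4c_taut[OF int_taut.disj3]] thy_mp by blast

lemma thy_Bot: "thy T \<Longrightarrow> \<^bold>\<bottom> \<in> T \<Longrightarrow> \<phi> \<in> T"
  using thy_imp[OF _ GS4c_taut[OF int_taut.efq]] by blast

lemma Imp_trans: "thy T \<Longrightarrow> \<phi> \<^bold>\<rightarrow> \<psi> \<in> T \<Longrightarrow> \<psi> \<^bold>\<rightarrow> \<chi> \<in> T \<Longrightarrow> \<phi> \<^bold>\<rightarrow> \<chi> \<in> T"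
  by (rule thy_ImpI) (use thy_mp in blast)+

lemma GS4c_Or_mono: "\<phi> \<^bold>\<rightarrow> \<phi>' \<in> GS4c \<Longrightarrow> \<psi> \<^bold>\<rightarrow> \<psi>' \<in> GS4c \<Longrightarrow> \<phi> \<^bold>\<or> \<psi> \<^bold>\<rightarrow> \<phi>' \<^bold>\<or> \<psi>' \<in> GS4c"
proof (rule GS4c_ImpI)
  fix U assume U: "thy U" and h: "\<phi> \<^bold>\<rightarrow> \<phi>' \<in> GS4c" "\<psi> \<^bold>\<rightarrow> \<psi>' \<in> GS4c" "\<phi> \<^bold>\<or> \<psi> \<in> U"
  show "\<phi>' \<^bold>\<or> \<psi>' \<in> U"
    by (rule thy_OrE[OF U h(3)]; rule thy_ImpI[OF U])
      (use h(1,2) thy_imp thy_OrI in blast)+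
qed

lemma GS4c_box_mono: "\<phi> \<^bold>\<rightarrow> \<psi> \<in> GS4c \<Longrightarrow> \<^bold>\<box> \<phi> \<^bold>\<rightarrow> \<^bold>\<box> \<psi> \<in> GS4c"
  using GS4c_mp[OF box_K GS4c_nec] .

lemma GS4c_dia_mono: "\<phi> \<^bold>\<rightarrow> \<psi> \<in> GS4c \<Longrightarrow> \<^bold>\<diamond> \<phi> \<^bold>\<rightarrow> \<^bold>\<diamond> \<psi> \<in> GS4c"
  using GS4c_mp[OF dia_K GS4c_nec] .

lemma thy_box_mono: "thy T \<Longrightarrow> \<phi> \<^bold>\<rightarrow> \<psi> \<in> GS4c \<Longrightarrow> \<^bold>\<box> \<phi> \<in> T \<Longrightarrow> \<^bold>\<box> \<psi> \<in> T"
  using thy_imp GS4c_box_mono by blast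

lemma thy_dia_mono: "thy T \<Longrightarrow> \<phi> \<^bold>\<rightarrow> \<psi> \<in> GS4c \<Longrightarrow> \<^bold>\<diamond> \<phi> \<in> T \<Longrightarrow> \<^bold>\<diamond> \<psi> \<in> T"
  using thy_imp GS4c_dia_mono by blast

definition unbox :: "fm set \<Rightarrow> fm set" where
  "unbox T = {\<phi>. \<^bold>\<box> \<phi> \<in> T}"

definition undia :: "fm set \<Rightarrow> fm set" where
  "undia T = {\<phi>. \<^bold>\<diamond> \<phi> \<in> T}"

lemma thy_unbox: assumes T: "thy T" shows "thy (unbox T)"
  unfolding thy_def unbox_def
  using thy_theorem[OF T] GS4c_nec thy_imp2[OF T box_K] by blast

section \<open>Prime theories and the Lindenbaum lemma\<close>

definition prime :: "fm set \<Rightarrow> bool" where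
  "prime T \<longleftrightarrow> thy T \<and> \<^bold>\<bottom> \<notin> T \<and> (\<forall>\<phi> \<psi>. \<phi> \<^bold>\<or> \<psi> \<in> T \<longrightarrow> \<phi> \<in> T \<or> \<psi> \<in> T)"

lemma prime_thy: "prime T \<Longrightarrow> thy T"
  by (simp add: prime_def)

lemma prime_Or: "prime T \<Longrightarrow> \<phi> \<^bold>\<or> \<psi> \<in> T \<longleftrightarrow> \<phi> \<in> T \<or> \<psi> \<in> T"
  using thy_OrI by (auto simp: prime_def)

text \<open>Source of every prime theory constructed below, each time with another \<open>D\<close>.
  A maximal theory avoiding \<open>D\<close> is prime: a formula outside it implies, over it, some
  member of \<open>D\<close>; for two missing disjuncts, directedness gives a common consequence in
  \<open>D\<close>, which the disjunction would then put into the theory.\<close>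

lemma prime_extension:
  assumes T: "thy T" and "D \<noteq> {}" and disj: "T \<inter> D = {}"
    and dir: "\<And>a b. a \<in> D \<Longrightarrow> b \<in> D \<Longrightarrow> \<exists>c\<in>D. a \<^bold>\<rightarrow> c \<in> GS4c \<and> b \<^bold>\<rightarrow> c \<in> GS4c"
  obtains P where "prime P" "T \<subseteq> P" "P \<inter> D = {}"
proof -
  let ?A = "{U. thy U \<and> T \<subseteq> U \<and> U \<inter> D = {}}"
  have "\<exists>M\<in>?A. \<forall>X\<in>?A. M \<subseteq> X \<longrightarrow> X = M"
  proof (rule subset_Zorn_nonempty)
    show "?A \<noteq> {}" using T disj by blast
    fix C assume "C \<noteq> {}" and C: "subset.chain ?A C"
    then obtain U0 where U0: "U0 \<in> C" by blast
    have sub: "C \<subseteq> ?A" and lin: "\<And>X Y. X \<in> C \<Longrightarrow> Y \<in> C \<Longrightarrow> X \<subseteq> Y \<or> Y \<subseteq> X"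
      using C by (auto simp: subset_chain_def)
    have "thy (\<Union>C)"
      unfolding thy_def
    proof (intro conjI allI impI)
      show "GS4c \<subseteq> \<Union>C" using U0 sub thy_theorem by blast
      fix a b assume "a \<^bold>\<rightarrow> b \<in> \<Union>C" "a \<in> \<Union>C"
      then obtain X Y where XY: "X \<in> C" "Y \<in> C" "a \<^bold>\<rightarrow> b \<in> X" "a \<in> Y" by blast
      then have "b \<in> X \<or> b \<in> Y"
        using lin[OF XY(1,2)] sub thy_mp by blast
      then show "b \<in> \<Union>C" using XY by blast
    qed
    then show "\<Union>C \<in> ?A" using U0 sub by blast
  qed
  then obtain M where M: "thy M" "T \<subseteq> M" "M \<inter> D = {}"
    and max: "\<And>X. thy X \<Longrightarrow> M \<subseteq> X \<Longrightarrow> X \<inter> D = {} \<Longrightarrow> X = M"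
    by (smt (verit, best) mem_Collect_eq order_trans)
  have meet: "\<exists>d\<in>D. a \<^bold>\<rightarrow> d \<in> M" if "a \<notin> M" for a
  proof -
    have "ext M a \<noteq> M" using ext_self[OF M(1)] that by blast
    then have "ext M a \<inter> D \<noteq> {}" using max[OF thy_ext[OF M(1)] ext_subset[OF M(1)]] by blast
    then show ?thesis by (auto simp: ext_def)
  qed
  have "a \<in> M \<or> b \<in> M" if ab: "a \<^bold>\<or> b \<in> M" for a b
  proof (rule ccontr)
    assume "\<not> (a \<in> M \<or> b \<in> M)"
    then obtain d e where d: "d \<in> D" "a \<^bold>\<rightarrow> d \<in> M" and e: "e \<in> D" "b \<^bold>\<rightarrow> e \<in> M"
      using meet by blast
    obtain c where c: "c \<in> D" "d \<^bold>\<rightarrow> c \<in> GS4c" "e \<^bold>\<rightarrow> c \<in> GS4c"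
      using dir[OF d(1) e(1)] by blast
    have "a \<^bold>\<rightarrow> c \<in> M" "b \<^bold>\<rightarrow> c \<in> M"
      using Imp_trans[OF M(1)] d(2) e(2) c(2,3) thy_theorem[OF M(1)] by blast+
    then have "c \<in> M" by (rule thy_OrE[OF M(1) ab])
    then show False using c(1) M(3) by blast
  qed
  moreover have "\<^bold>\<bottom> \<notin> M" using \<open>D \<noteq> {}\<close> M(1,3) thy_Bot by blast
  ultimately have "prime M" using M(1) by (auto simp: prime_def)
  then show ?thesis using that M(2,3) by blast
qed

lemma prime_avoiding:
  assumes "thy T" "\<phi> \<notin> T"
  obtains P where "prime P" "T \<subseteq> P" "\<phi> \<notin> P"
proof (rule prime_extension[of T "{\<phi>}"])
  show "\<exists>c\<in>{\<phi>}. a \<^bold>\<rightarrow> c \<in> GS4c \<and> b \<^bold>\<rightarrow> c \<in> GS4c" if "a \<in> {\<phi>}" "b \<in> {\<phi>}" for a b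
    using that GS4c_taut[OF Imp_refl] by blast
qed (use assms that in auto)

text \<open>The truth lemma for implication in the canonical model; a missing implication is refuted
  by a prime extension of \<open>ext T \<phi>\<close> that avoids \<open>\<psi>\<close>.\<close>

lemma prime_Imp:
  assumes "thy T"
  shows "\<phi> \<^bold>\<rightarrow> \<psi> \<in> T \<longleftrightarrow> (\<forall>P. prime P \<longrightarrow> T \<subseteq> P \<longrightarrow> \<phi> \<in> P \<longrightarrow> \<psi> \<in> P)"
proof
  show "\<forall>P. prime P \<longrightarrow> T \<subseteq> P \<longrightarrow> \<phi> \<in> P \<longrightarrow> \<psi> \<in> P" if "\<phi> \<^bold>\<rightarrow> \<psi> \<in> T"
    using that thy_mp prime_thy by blast
  show "\<phi> \<^bold>\<rightarrow> \<psi> \<in> T" if h: "\<forall>P. prime P \<longrightarrow> T \<subseteq> P \<longrightarrow> \<phi> \<in> P \<longrightarrow> \<psi> \<in> P"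
  proof (rule ccontr)
    assume "\<phi> \<^bold>\<rightarrow> \<psi> \<notin> T"
    then have "\<psi> \<notin> ext T \<phi>" by (simp add: ext_def)
    then obtain P where "prime P" "ext T \<phi> \<subseteq> P" "\<psi> \<notin> P"
      using prime_avoiding[OF thy_ext[OF assms]] by blast
    then show False
      using h ext_subset[OF assms, of \<phi>] ext_self[OF assms, of \<phi>] by blast
  qed
qed

text \<open>For \<open>a\<close> in \<open>P\<close> but not in \<open>Q\<close> and
  \<open>b\<close> in \<open>Q\<close> but not in \<open>P\<close>, whichever implication between
  them lies in \<open>T\<close> would put \<open>b\<close> into \<open>P\<close> or \<open>a\<close>
  into \<open>Q\<close>.\<close>

lemma prime_linear:
  assumes "thy T" "prime P" "prime Q" "T \<subseteq> P" "T \<subseteq> Q"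
    and "\<And>a b. a \<^bold>\<rightarrow> b \<in> T \<or> b \<^bold>\<rightarrow> a \<in> T"
  shows "P \<subseteq> Q \<or> Q \<subseteq> P"
  using assms thy_mp prime_thy by (meson subset_eq)

lemma prime_upward_linear:
  assumes T: "prime T" and "prime P" "prime Q" "T \<subseteq> P" "T \<subseteq> Q"
  shows "P \<subseteq> Q \<or> Q \<subseteq> P"
proof (rule prime_linear[OF prime_thy[OF T] assms(2-5)])
  show "a \<^bold>\<rightarrow> b \<in> T \<or> b \<^bold>\<rightarrow> a \<in> T" for a b
    using prime_Or[OF T] thy_theorem[OF prime_thy[OF T] linearity] by blast
qed

section \<open>The canonical accessibility relation\<close>

definition acc :: "fm set \<Rightarrow> fm set \<Rightarrow> bool" where
  "acc w v \<longleftrightarrow> unbox w \<subseteq> v \<and> v \<subseteq> undia w"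

lemma acc_refl: "prime w \<Longrightarrow> acc w w"
  using thy_imp[OF prime_thy box_T] thy_imp[OF prime_thy dia_T]
  by (auto simp: acc_def unbox_def undia_def)

lemma dia_Or_iff: "prime w \<Longrightarrow> a \<^bold>\<or> b \<in> undia w \<longleftrightarrow> a \<in> undia w \<or> b \<in> undia w"
proof
  assume w: "prime w"
  note T = prime_thy[OF w]
  show "a \<in> undia w \<or> b \<in> undia w" if "a \<^bold>\<or> b \<in> undia w"
    using that thy_imp[OF T dia_Or] prime_Or[OF w] by (auto simp: undia_def)
  show "a \<^bold>\<or> b \<in> undia w" if "a \<in> undia w \<or> b \<in> undia w"
    using that thy_dia_mono[OF T GS4c_taut[OF int_taut.disj1]]
      thy_dia_mono[OF T GS4c_taut[OF int_taut.disj2]] by (auto simp: undia_def)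
qed

lemma Bot_notin_undia: "prime w \<Longrightarrow> \<^bold>\<bottom> \<notin> undia w"
  using thy_mp[OF prime_thy thy_theorem[OF prime_thy dia_Bot]]
  by (auto simp: undia_def prime_def)

text \<open>In general \<open>undia w\<close> is not a theory, so remaining inside it is phrased as
  avoiding its complement, which \<open>dia_Or_iff\<close> makes directed and
  \<open>Bot_notin_undia\<close> nonempty.\<close>

lemma extension_in_undia:
  assumes w: "prime w" and T: "thy T" "T \<subseteq> undia w"
  obtains P where "prime P" "T \<subseteq> P" "P \<subseteq> undia w"
proof (rule prime_extension[of T "- undia w"])
  show "- undia w \<noteq> {}" using Bot_notin_undia[OF w] by blast
  show "\<exists>c\<in>- undia w. a \<^bold>\<rightarrow> c \<in> GS4c \<and> b \<^bold>\<rightarrow> c \<in> GS4c"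
    if "a \<in> - undia w" "b \<in> - undia w" for a b
    using that dia_Or_iff[OF w] GS4c_taut int_taut.disj1 int_taut.disj2
    by (intro bexI[of _ "a \<^bold>\<or> b"]) auto
qed (use assms that in blast)+

text \<open>The theory generated by \<open>v\<close> and \<open>unbox w'\<close> must be kept inside
  \<open>undia w'\<close>. If \<open>\<chi> \<rightarrow> \<psi>\<close> is in \<open>v\<close> and
  \<open>Box \<chi>\<close> in \<open>w'\<close>, the implication is possible in \<open>w\<close>,
  hence in \<open>w'\<close>, and the boxed \<open>\<chi>\<close> then makes \<open>\<psi>\<close>
  possible in \<open>w'\<close>.\<close>

lemma canonical_forth_up:
  assumes p: "prime w" "prime w'" "prime v" and "w \<subseteq> w'" and "acc w v"
  obtains v' where "prime v'" "v \<subseteq> v'" "acc w' v'"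
proof -
  \<comment> \<open>One \<open>\<chi>\<close> suffices because \<open>unbox w'\<close> is closed
    under conjunction.\<close>
  let ?T = "{\<psi>. \<exists>\<chi>. \<^bold>\<box> \<chi> \<in> w' \<and> \<chi> \<^bold>\<rightarrow> \<psi> \<in> v}"
  note T = prime_thy[OF p(1)] prime_thy[OF p(2)] prime_thy[OF p(3)]
  have top: "\<^bold>\<box> (\<phi> \<^bold>\<rightarrow> \<phi>) \<in> w'" for \<phi>
    using GS4c_nec GS4c_taut Imp_refl thy_theorem T(2) by blast
  have sub1: "v \<subseteq> ?T"
    using top thy_weaken[OF T(3)] by blast
  have sub2: "unbox w' \<subseteq> ?T"
    using thy_theorem[OF T(3) GS4c_taut[OF Imp_refl]] by (auto simp: unbox_def)
  have "thy ?T"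
    unfolding thy_def
  proof (intro conjI allI impI)
    show "GS4c \<subseteq> ?T" using sub1 thy_theorem[OF T(3)] by blast
    fix \<phi> \<psi> assume "\<phi> \<^bold>\<rightarrow> \<psi> \<in> ?T" "\<phi> \<in> ?T"
    then obtain a b where a: "\<^bold>\<box> a \<in> w'" "a \<^bold>\<rightarrow> \<phi> \<^bold>\<rightarrow> \<psi> \<in> v" and b: "\<^bold>\<box> b \<in> w'" "b \<^bold>\<rightarrow> \<phi> \<in> v"
      by blast
    have "\<^bold>\<box> (a \<^bold>\<and> b) \<in> w'"
      using thy_And[OF thy_unbox[OF T(2)], of a b] a(1) b(1) by (simp add: unbox_def)
    moreover have "a \<^bold>\<and> b \<^bold>\<rightarrow> \<psi> \<in> v"
    proof (rule thy_ImpI[OF T(3)])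
      fix U assume U: "thy U" "v \<subseteq> U" "a \<^bold>\<and> b \<in> U"
      then show "\<psi> \<in> U" using a(2) b(2) thy_And[OF U(1)] thy_mp[OF U(1)] by blast
    qed
    ultimately show "\<psi> \<in> ?T" by blast
  qed
  moreover have "?T \<subseteq> undia w'"
  proof
    fix \<psi> assume "\<psi> \<in> ?T"
    then obtain \<chi> where \<chi>: "\<^bold>\<box> \<chi> \<in> w'" "\<chi> \<^bold>\<rightarrow> \<psi> \<in> v" by blast
    then have d: "\<^bold>\<diamond> (\<chi> \<^bold>\<rightarrow> \<psi>) \<in> w'"
      using \<open>acc w v\<close> \<open>w \<subseteq> w'\<close> by (auto simp: acc_def undia_def)
    have "\<chi> \<^bold>\<rightarrow> (\<chi> \<^bold>\<rightarrow> \<psi>) \<^bold>\<rightarrow> \<psi> \<in> GS4c"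
      by (rule GS4c_ImpI, rule thy_ImpI) (use thy_mp in blast)+
    from thy_box_mono[OF T(2) this \<chi>(1)] d show "\<psi> \<in> undia w'"
      using thy_imp2[OF T(2) dia_K] by (auto simp: undia_def)
  qed
  ultimately obtain v' where "prime v'" "?T \<subseteq> v'" "v' \<subseteq> undia w'"
    using extension_in_undia[OF p(2)] by blast
  then show ?thesis using that sub1 sub2 unfolding acc_def by (meson order_trans)
qed

text \<open>The theory sought contains \<open>w\<close> and \<open>Dia \<psi>\<close> for all
  \<open>\<psi>\<close> in \<open>v'\<close>, and avoids \<open>Box \<chi>\<close> for all
  \<open>\<chi>\<close> outside \<open>v'\<close>. A conflict puts some
  \<open>Dia \<psi> \<rightarrow> Box \<chi>\<close> into \<open>w\<close>; by
  \<open>dia_box_Imp\<close> the implication \<open>\<psi> \<rightarrow> \<chi>\<close> is then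
  necessary in \<open>w\<close> and so lies in \<open>v'\<close>.\<close>

lemma canonical_back_up:
  assumes p: "prime w" "prime v" "prime v'" and "acc w v" and "v \<subseteq> v'"
  obtains w' where "prime w'" "w \<subseteq> w'" "acc w' v'"
proof -
  let ?T = "{\<theta>. \<exists>\<psi>\<in>v'. \<^bold>\<diamond> \<psi> \<^bold>\<rightarrow> \<theta> \<in> w}"
  let ?D = "{\<^bold>\<box> \<chi> |\<chi>. \<chi> \<notin> v'}"
  note T = prime_thy[OF p(1)] prime_thy[OF p(2)] prime_thy[OF p(3)]
  have sub1: "w \<subseteq> ?T"
    using thy_weaken[OF T(1)] thy_theorem[OF T(3) GS4c_taut[OF Imp_refl]] by blast
  have sub2: "\<^bold>\<diamond> \<psi> \<in> ?T" if "\<psi> \<in> v'" for \<psi>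
    using that thy_theorem[OF T(1) GS4c_taut[OF Imp_refl]] by blast
  have thyT: "thy ?T"
    unfolding thy_def
  proof (intro conjI allI impI)
    show "GS4c \<subseteq> ?T" using sub1 thy_theorem[OF T(1)] by blast
    fix \<phi> \<psi> assume "\<phi> \<^bold>\<rightarrow> \<psi> \<in> ?T" "\<phi> \<in> ?T"
    then obtain a b where a: "a \<in> v'" "\<^bold>\<diamond> a \<^bold>\<rightarrow> \<phi> \<^bold>\<rightarrow> \<psi> \<in> w" and b: "b \<in> v'" "\<^bold>\<diamond> b \<^bold>\<rightarrow> \<phi> \<in> w"
      by blast
    have "a \<^bold>\<and> b \<in> v'" using thy_And[OF T(3)] a(1) b(1) by blast
    moreover have "\<^bold>\<diamond> (a \<^bold>\<and> b) \<^bold>\<rightarrow> \<psi> \<in> w"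
    proof (rule thy_ImpI[OF T(1)])
      fix U assume U: "thy U" "w \<subseteq> U" "\<^bold>\<diamond> (a \<^bold>\<and> b) \<in> U"
      then have "\<^bold>\<diamond> a \<in> U" "\<^bold>\<diamond> b \<in> U"
        using thy_dia_mono[OF U(1)] GS4c_taut int_taut.conj1 int_taut.conj2 by blast+
      then show "\<psi> \<in> U" using a(2) b(2) U(2) thy_mp[OF U(1)] by blast
    qed
    ultimately show "\<psi> \<in> ?T" by blast
  qed
  have "?T \<inter> ?D = {}"
  proof (rule ccontr)
    assume "?T \<inter> ?D \<noteq> {}"
    then obtain \<chi> \<psi> where h: "\<chi> \<notin> v'" "\<psi> \<in> v'" "\<^bold>\<diamond> \<psi> \<^bold>\<rightarrow> \<^bold>\<box> \<chi> \<in> w" by blast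
    then have "\<^bold>\<box> (\<psi> \<^bold>\<rightarrow> \<chi>) \<in> w" using thy_imp[OF T(1) dia_box_Imp] by blast
    then have "\<psi> \<^bold>\<rightarrow> \<chi> \<in> v'"
      using \<open>acc w v\<close> \<open>v \<subseteq> v'\<close> by (auto simp: acc_def unbox_def)
    then show False using h thy_mp[OF T(3)] by blast
  qed
  moreover have "?D \<noteq> {}" using p(3) by (auto simp: prime_def)
  moreover have "\<exists>c\<in>?D. a \<^bold>\<rightarrow> c \<in> GS4c \<and> b \<^bold>\<rightarrow> c \<in> GS4c" if ab: "a \<in> ?D" "b \<in> ?D" for a b
  proof -
    obtain x y where xy: "a = \<^bold>\<box> x" "b = \<^bold>\<box> y" "x \<notin> v'" "y \<notin> v'" using ab by blast
    then have "\<^bold>\<box> (x \<^bold>\<or> y) \<in> ?D" using prime_Or[OF p(3)] by blast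
    then show ?thesis
      using GS4c_box_mono GS4c_taut int_taut.disj1 int_taut.disj2 xy(1,2) by blast
  qed
  ultimately obtain w' where w': "prime w'" "?T \<subseteq> w'" "w' \<inter> ?D = {}"
    using prime_extension[OF thyT, of ?D] by blast
  have "acc w' v'"
    using w' sub2 unfolding acc_def unbox_def undia_def by blast
  then show ?thesis using that w'(1,2) sub1 by blast
qed

text \<open>Two upper bounds, \<open>v'\<close> and \<open>undia w\<close>, have to be met at once.
  Avoiding the disjunctions \<open>a \<or> b\<close> with \<open>a\<close> outside the first and
  \<open>b\<close> outside the second does both, as either disjunct may be \<open>Bot\<close>. If
  such a disjunction were necessary in \<open>w\<close>, \<open>box_Or\<close> would give
  \<open>Box a\<close> in \<open>w\<close>, hence in \<open>v\<close>, and so \<open>a\<close> in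
  \<open>v'\<close>.\<close>

lemma canonical_forth_down:
  assumes p: "prime w" "prime v" "prime v'" and "w \<subseteq> v" and "acc v v'"
  obtains w' where "prime w'" "acc w w'" "w' \<subseteq> v'"
proof -
  let ?D = "{a \<^bold>\<or> b |a b. a \<notin> v' \<and> b \<notin> undia w}"
  note T = prime_thy[OF p(1)] prime_thy[OF p(2)] prime_thy[OF p(3)]
  have D: "a \<^bold>\<or> b \<in> ?D" if "a \<notin> v'" "b \<notin> undia w" for a b using that by blast
  have "unbox w \<inter> ?D = {}"
  proof (rule ccontr)
    assume "unbox w \<inter> ?D \<noteq> {}"
    then obtain a b where h: "a \<notin> v'" "\<^bold>\<diamond> b \<notin> w" "\<^bold>\<box> (a \<^bold>\<or> b) \<in> w"
      by (auto simp: unbox_def undia_def)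
    then have "\<^bold>\<box> a \<in> w" using thy_imp[OF T(1) box_Or] prime_Or[OF p(1)] by blast
    then show False using h(1) assms(4,5) by (auto simp: acc_def unbox_def)
  qed
  moreover have "?D \<noteq> {}" using p(3) Bot_notin_undia[OF p(1)] unfolding prime_def by blast
  moreover have "\<exists>c\<in>?D. x \<^bold>\<rightarrow> c \<in> GS4c \<and> y \<^bold>\<rightarrow> c \<in> GS4c" if "x \<in> ?D" "y \<in> ?D" for x y
  proof -
    obtain a b a' b' where h: "x = a \<^bold>\<or> b" "y = a' \<^bold>\<or> b'" "a \<notin> v'" "a' \<notin> v'"
      "b \<notin> undia w" "b' \<notin> undia w" using \<open>x \<in> ?D\<close> \<open>y \<in> ?D\<close> by blast
    then have "(a \<^bold>\<or> a') \<^bold>\<or> (b \<^bold>\<or> b') \<in> ?D"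
      using prime_Or[OF p(3)] dia_Or_iff[OF p(1)] by blast
    then show ?thesis
      using GS4c_Or_mono GS4c_taut int_taut.disj1 int_taut.disj2 h(1,2) by blast
  qed
  ultimately obtain w' where w': "prime w'" "unbox w \<subseteq> w'" "w' \<inter> ?D = {}"
    using prime_extension[OF thy_unbox[OF T(1)], of ?D] by blast
  have Or: "a \<in> v' \<or> b \<in> undia w" if "a \<^bold>\<or> b \<in> w'" for a b
    using that w'(3) D by blast
  have "w' \<subseteq> v'"
    using Or[of _ "\<^bold>\<bottom>"] Bot_notin_undia[OF p(1)] thy_OrI[OF prime_thy[OF w'(1)]] by blast
  moreover have "w' \<subseteq> undia w"
    using Or[of "\<^bold>\<bottom>"] p(3) thy_OrI[OF prime_thy[OF w'(1)]] unfolding prime_def by blast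
  ultimately show ?thesis using that w'(1,2) by (simp add: acc_def)
qed

lemma canonical_dia:
  assumes w: "prime w" and "\<^bold>\<diamond> \<psi> \<in> w"
  obtains v where "prime v" "acc w v" "\<psi> \<in> v"
proof -
  note T = prime_thy[OF w]
  have "ext (unbox w) \<psi> \<subseteq> undia w"
    using thy_imp2[OF T dia_K] assms(2) by (auto simp: ext_def unbox_def undia_def)
  then obtain v where "prime v" "ext (unbox w) \<psi> \<subseteq> v" "v \<subseteq> undia w"
    using extension_in_undia[OF w thy_ext[OF thy_unbox[OF T]]] by blast
  then show ?thesis
    using that ext_subset[OF thy_unbox[OF T], of \<psi>] ext_self[OF thy_unbox[OF T], of \<psi>]
    unfolding acc_def by blast
qed

text \<open>The construction of \<open>canonical_forth_down\<close>, with the single formula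
  \<open>\<psi>\<close> in place of the formulas outside \<open>v'\<close>.\<close>

lemma canonical_box:
  assumes w: "prime w" and "\<^bold>\<box> \<psi> \<notin> w"
  obtains v where "prime v" "acc w v" "\<psi> \<notin> v"
proof -
  let ?D = "{\<psi> \<^bold>\<or> b |b. b \<notin> undia w}"
  note T = prime_thy[OF w]
  have "unbox w \<inter> ?D = {}"
    using assms(2) thy_imp[OF T box_Or] prime_Or[OF w] by (auto simp: unbox_def undia_def)
  moreover have "?D \<noteq> {}" using Bot_notin_undia[OF w] by blast
  moreover have "\<exists>c\<in>?D. x \<^bold>\<rightarrow> c \<in> GS4c \<and> y \<^bold>\<rightarrow> c \<in> GS4c" if "x \<in> ?D" "y \<in> ?D" for x y
  proof -
    obtain b b' where h: "x = \<psi> \<^bold>\<or> b" "y = \<psi> \<^bold>\<or> b'" "b \<notin> undia w" "b' \<notin> undia w"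
      using \<open>x \<in> ?D\<close> \<open>y \<in> ?D\<close> by blast
    then have "\<psi> \<^bold>\<or> (b \<^bold>\<or> b') \<in> ?D"
      using dia_Or_iff[OF w] by blast
    then show ?thesis
      using GS4c_Or_mono GS4c_taut int_taut.disj1 int_taut.disj2 Imp_refl h(1,2) by blast
  qed
  ultimately obtain v where v: "prime v" "unbox w \<subseteq> v" "v \<inter> ?D = {}"
    using prime_extension[OF thy_unbox[OF T], of ?D] by blast
  have "\<psi> \<notin> v" "v \<subseteq> undia w"
    using v(3) Bot_notin_undia[OF w] thy_OrI[OF prime_thy[OF v(1)]] by blast+
  then show ?thesis using that v(1,2) by (simp add: acc_def)
qed

text \<open>Given \<open>c \<sqsubseteq> d\<close> above \<open>s\<close> from forth-up confluence, either \<open>d \<subseteq> v\<close> already, or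
  \<open>v \<subseteq> d\<close> by linearity, and then \<open>v\<close> itself is accessible from \<open>c\<close>.\<close>

lemma canonical_interpolation:
  assumes p: "prime r" "prime c" "prime w" "prime s" "prime v"
    and "acc r s" "acc w v" "r \<subseteq> c" "c \<subseteq> w" "s \<subseteq> v"
  obtains d where "prime d" "s \<subseteq> d" "d \<subseteq> v" "acc c d"
proof -
  obtain d where d: "prime d" "s \<subseteq> d" "acc c d"
    using canonical_forth_up[OF p(1,2,4) \<open>r \<subseteq> c\<close> \<open>acc r s\<close>] by blast
  show ?thesis
  proof (cases "d \<subseteq> v")
    case True
    then show ?thesis using that d by blast
  next
    case False
    then have "v \<subseteq> d" using prime_upward_linear[OF p(4) d(1) p(5) d(2) \<open>s \<subseteq> v\<close>] by blast
    \<comment> \<open>The lower half comes from \<open>c \<subseteq> w\<close> and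
      \<open>acc w v\<close>, the upper half from \<open>v \<subseteq> d\<close> and
      \<open>acc c d\<close>.\<close>
    then have "acc c v"
      using d(3) \<open>acc w v\<close> \<open>c \<subseteq> w\<close> by (auto simp: acc_def unbox_def)
    then show ?thesis using that[of v] p(5) \<open>s \<subseteq> v\<close> by blast
  qed
qed

section \<open>The finite quotient\<close>

primrec subf :: "fm \<Rightarrow> fm set" where
  "subf (Var p) = {Var p}"
| "subf Bot = {Bot}"
| "subf (And \<phi> \<psi>) = insert (And \<phi> \<psi>) (subf \<phi> \<union> subf \<psi>)"
| "subf (Or \<phi> \<psi>) = insert (Or \<phi> \<psi>) (subf \<phi> \<union> subf \<psi>)"
| "subf (Imp \<phi> \<psi>) = insert (Imp \<phi> \<psi>) (subf \<phi> \<union> subf \<psi>)"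
| "subf (Dia \<phi>) = insert (Dia \<phi>) (subf \<phi>)"
| "subf (Box \<phi>) = insert (Box \<phi>) (subf \<phi>)"

definition subf_closed :: "fm set \<Rightarrow> bool" where
  "subf_closed S \<longleftrightarrow> (\<forall>\<phi>\<in>S. subf \<phi> \<subseteq> S)"

lemma subf_self: "\<phi> \<in> subf \<phi>"
  by (cases \<phi>) auto

lemma finite_subf: "finite (subf \<phi>)"
  by (induction \<phi>) auto

lemma subf_trans: "\<psi> \<in> subf \<phi> \<Longrightarrow> subf \<psi> \<subseteq> subf \<phi>"
  by (induction \<phi>) auto

lemma subf_closed_subf: "subf_closed (subf \<phi>)"
  using subf_trans by (auto simp: subf_closed_def)

lemma subf_closedD:
  assumes "subf_closed S"
  shows "And \<phi> \<psi> \<in> S \<Longrightarrow> \<phi> \<in> S \<and> \<psi> \<in> S"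
    and "Or \<phi> \<psi> \<in> S \<Longrightarrow> \<phi> \<in> S \<and> \<psi> \<in> S"
    and "Imp \<phi> \<psi> \<in> S \<Longrightarrow> \<phi> \<in> S \<and> \<psi> \<in> S"
    and "Dia \<phi> \<in> S \<Longrightarrow> \<phi> \<in> S"
    and "Box \<phi> \<in> S \<Longrightarrow> \<phi> \<in> S"
  using assms subf_self unfolding subf_closed_def by fastforce+

text \<open>Makes the size of the quotient depend on nothing but the code of the formula.\<close>

lemma fm_code_subf: "\<psi> \<in> subf \<phi> \<Longrightarrow> fm_code \<psi> \<le> fm_code \<phi>"
  by (induction \<phi>) (auto intro: order_trans[OF _ le_prod_encode_2]
      order_trans[OF _ order_trans[OF le_prod_encode_1 le_prod_encode_2]]
      order_trans[OF _ order_trans[OF le_prod_encode_2 le_prod_encode_2]])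

text \<open>Types are stored as numbers, so that the quotient is a \<open>nat frame\<close> from the
  start and its worlds can be bounded in advance.\<close>

definition label :: "fm set \<Rightarrow> fm set \<Rightarrow> nat" where
  "label S w = set_encode (fm_code ` (w \<inter> S))"

definition chain_label :: "fm set \<Rightarrow> fm set \<Rightarrow> nat" where
  "chain_label S r = set_encode (label S ` {u. prime u \<and> r \<subseteq> u})"

text \<open>The root enters through its chain label alone, so representatives of one point may have
  unrelated roots; \<open>point_lift\<close> passes between them.\<close>

definition point :: "fm set \<Rightarrow> fm set \<Rightarrow> fm set \<Rightarrow> nat" where
  "point S r w = prod_encode (chain_label S r, label S w)"

definition rooted :: "fm set \<Rightarrow> fm set \<Rightarrow> bool" where
  "rooted r w \<longleftrightarrow> prime r \<and> prime w \<and> r \<subseteq> w"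

lemma rootedD: "rooted r w \<Longrightarrow> prime r" "rooted r w \<Longrightarrow> prime w" "rooted r w \<Longrightarrow> r \<subseteq> w"
  by (auto simp: rooted_def)

definition quot_le :: "fm set \<Rightarrow> nat rel" where
  "quot_le S = {(point S r w, point S r v) |r w v. rooted r w \<and> rooted r v \<and> w \<subseteq> v}"

text \<open>Although \<open>acc\<close> is transitive on prime theories, this image need not be: two
  consecutive steps may use different representatives of the middle point.\<close>

definition quot_step :: "fm set \<Rightarrow> nat rel" where
  "quot_step S = {(point S r w, point S s v) |r w s v.
     rooted r w \<and> rooted s v \<and> acc r s \<and> acc w v}"

definition quot :: "fm set \<Rightarrow> nat frame" where
  "quot S = \<lparr>worlds = {point S r w |r w. rooted r w}, fallible = {},
     le = quot_le S, sq = (quot_step S)\<^sup>+\<rparr>"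

definition quot_val :: "fm set \<Rightarrow> nat \<Rightarrow> nat set" where
  "quot_val S p = {point S r w |r w. rooted r w \<and> Var p \<in> w \<inter> S}"

section \<open>Types and points: equality, size, change of representatives\<close>

lemma label_eq: "finite S \<Longrightarrow> label S w = label S v \<longleftrightarrow> w \<inter> S = v \<inter> S"
  unfolding label_def by (simp add: set_encode_eq inj_image_eq_iff[OF inj_fm_code])

lemma set_encode_less:
  assumes "A \<subseteq> {..<n}" shows "set_encode A < 2 ^ n"
proof -
  have "set_encode A \<le> (\<Sum>i<n. 2 ^ i)"
    unfolding set_encode_def by (rule sum_mono2) (use assms in auto)
  also have "\<dots> < 2 ^ n"
    by (induction n) auto
  finally show ?thesis .
qed

lemma label_less: "fm_code ` S \<subseteq> {..<n} \<Longrightarrow> label S w < 2 ^ n"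
  unfolding label_def by (rule set_encode_less) auto

lemma finite_labels:
  assumes "finite S" shows "finite (label S ` A)"
proof (rule finite_subset)
  show "label S ` A \<subseteq> (\<lambda>B. set_encode (fm_code ` B)) ` Pow S"
    by (auto simp: label_def)
qed (use assms in simp)

lemma triangle_mono: "m \<le> n \<Longrightarrow> triangle m \<le> triangle n"
  by (induction n rule: dec_induct) auto

lemma prod_encode_mono: "a \<le> c \<Longrightarrow> b \<le> d \<Longrightarrow> prod_encode (a, b) \<le> prod_encode (c, d)"
  unfolding prod_encode_def by (auto intro!: add_mono triangle_mono)

text \<open>Labels code sets of numbers below \<open>n\<close>, and chain labels code sets of
  labels; hence one and two exponentials.\<close>

lemma point_less:
  assumes "fm_code ` S \<subseteq> {..<n}"
  shows "point S r w < Suc (prod_encode (2 ^ 2 ^ n, 2 ^ n))"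
proof -
  have "chain_label S r < 2 ^ 2 ^ n"
    unfolding chain_label_def by (rule set_encode_less) (use label_less[OF assms] in auto)
  then show ?thesis
    unfolding point_def less_Suc_eq_le
    using label_less[OF assms] by (intro prod_encode_mono less_imp_le)
qed

lemma point_eqD:
  assumes "finite S" "point S r w = point S r' w'"
  shows "w \<inter> S = w' \<inter> S"
    and "rooted r' v' \<Longrightarrow> \<exists>v. prime v \<and> r \<subseteq> v \<and> v \<inter> S = v' \<inter> S"
proof -
  show "w \<inter> S = w' \<inter> S" using assms by (simp add: point_def label_eq)
  assume "rooted r' v'"
  then have "label S v' \<in> label S ` {u. prime u \<and> r' \<subseteq> u}" by (auto simp: rooted_def)
  also have "\<dots> = label S ` {u. prime u \<and> r \<subseteq> u}"
    using assms finite_labels[OF assms(1)] by (simp add: point_def chain_label_def set_encode_eq)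
  finally show "\<exists>v. prime v \<and> r \<subseteq> v \<and> v \<inter> S = v' \<inter> S"
    using label_eq[OF assms(1)] by blast
qed

lemma point_eqI:
  assumes "point S r w = point S r' w'" "v \<inter> S = v' \<inter> S"
  shows "point S r v = point S r' v'"
  using assms by (simp add: point_def label_def)

text \<open>Equal chain labels provide some \<open>u\<close> above \<open>r\<close> with the type of
  \<open>v'\<close>. If this type differs from that of \<open>w\<close>, it decides which of the
  comparable theories \<open>w\<close> and \<open>u\<close> is the larger; if it is the same,
  \<open>w\<close> itself is taken and both inclusions are trivial.\<close>

lemma point_lift:
  assumes S: "finite S" and e: "point S r w = point S r' w'" and rw: "rooted r w"
    and rv': "rooted r' v'"
  obtains v where "rooted r v" "point S r v = point S r' v'"
    "w' \<subseteq> v' \<Longrightarrow> w \<subseteq> v" "v' \<subseteq> w' \<Longrightarrow> v \<subseteq> w"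
proof -
  obtain u where u: "prime u" "r \<subseteq> u" "u \<inter> S = v' \<inter> S"
    using point_eqD(2)[OF S e rv'] by blast
  then have ru: "rooted r u" using rw by (simp add: rooted_def)
  have pu: "point S r u = point S r' v'" by (rule point_eqI[OF e u(3)])
  have ws: "w \<inter> S = w' \<inter> S" by (rule point_eqD(1)[OF S e])
  have lin: "w \<subseteq> u \<or> u \<subseteq> w"
    using prime_upward_linear[of r w u] rw u(1,2) by (auto simp: rooted_def)
  show ?thesis
  proof (cases "u \<inter> S = w \<inter> S")
    case True
    then have "point S r w = point S r' v'"
      using point_eqI[OF e, of w v'] u(3) by simp
    then show ?thesis using that[OF rw] by blast
  next
    case False
    then have "w \<subseteq> u" if "w' \<subseteq> v'" using that lin u(3) ws by blast
    moreover have "u \<subseteq> w" if "v' \<subseteq> w'" using that False lin u(3) ws by blast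
    ultimately show ?thesis using that[OF ru pu] by blast
  qed
qed

lemma quot_le_refl: "rooted r w \<Longrightarrow> (point S r w, point S r w) \<in> quot_le S"
  unfolding quot_le_def by blast

lemma quot_leI: "rooted r w \<Longrightarrow> rooted r v \<Longrightarrow> w \<subseteq> v \<Longrightarrow> (point S r w, point S r v) \<in> quot_le S"
  unfolding quot_le_def by blast

lemma quot_stepI:
  "rooted r w \<Longrightarrow> rooted s v \<Longrightarrow> acc r s \<Longrightarrow> acc w v \<Longrightarrow> (point S r w, point S s v) \<in> quot_step S"
  unfolding quot_step_def by blast

text \<open>The representative of the lower point is free to choose, and the upper point then has
  one over the same root. Transitivity, linearity and the clause for implication all rest on
  this.\<close>

lemma quot_le_up:
  assumes "finite S" "rooted r w" "(point S r w, y) \<in> quot_le S"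
  obtains v where "rooted r v" "w \<subseteq> v" "y = point S r v"
proof -
  obtain r' w' v' where h: "point S r w = point S r' w'" "y = point S r' v'"
    "rooted r' v'" "w' \<subseteq> v'"
    using assms(3) unfolding quot_le_def by blast
  show ?thesis
    by (rule point_lift[OF assms(1) h(1) assms(2) h(3)]) (metis that h(2,4))
qed

lemma quot_le_down:
  assumes "finite S" "rooted r w" "(y, point S r w) \<in> quot_le S"
  obtains v where "rooted r v" "v \<subseteq> w" "y = point S r v"
proof -
  obtain r' w' v' where h: "point S r w = point S r' w'" "y = point S r' v'"
    "rooted r' v'" "v' \<subseteq> w'"
    using assms(3) unfolding quot_le_def by blast
  show ?thesis
    by (rule point_lift[OF assms(1) h(1) assms(2) h(3)]) (metis that h(2,4))
qed

lemma quot_leE: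
  assumes "(x, y) \<in> quot_le S"
  obtains r w v where "x = point S r w" "y = point S r v" "rooted r w" "rooted r v" "w \<subseteq> v"
  using assms unfolding quot_le_def by blast

lemma quot_stepE:
  assumes "(x, y) \<in> quot_step S"
  obtains r w s v where "x = point S r w" "y = point S s v" "rooted r w" "rooted s v"
    "acc r s" "acc w v"
  using assms unfolding quot_step_def by blast

lemma rooted_mono: "rooted r w \<Longrightarrow> prime v \<Longrightarrow> w \<subseteq> v \<Longrightarrow> rooted r v"
  by (auto simp: rooted_def)

section \<open>Frame conditions of the quotient\<close>

lemma step_forth_up:
  assumes S: "finite S" and "(x, x') \<in> quot_le S" "(x, y) \<in> quot_step S"
  shows "\<exists>y'. (y, y') \<in> quot_le S \<and> (x', y') \<in> quot_step S"
  using assms(3)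
proof (rule quot_stepE)
  fix r w s v assume h: "x = point S r w" "y = point S s v" "rooted r w" "rooted s v"
    "acc r s" "acc w v"
  obtain w' where w': "rooted r w'" "w \<subseteq> w'" "x' = point S r w'"
    using quot_le_up[OF S h(3)] assms(2) h(1) by blast
  obtain v' where "prime v'" "v \<subseteq> v'" "acc w' v'"
    using canonical_forth_up[OF rootedD(2)[OF h(3)] rootedD(2)[OF w'(1)] rootedD(2)[OF h(4)] w'(2) h(6)]
    by blast
  then show ?thesis
    using quot_leI[OF h(4)] quot_stepI[OF w'(1)] rooted_mono[OF h(4)] h(2,5) w'(3) by blast
qed

lemma step_back_up:
  assumes S: "finite S" and "(x, y) \<in> quot_step S" "(y, y') \<in> quot_le S"
  shows "\<exists>x'. (x, x') \<in> quot_le S \<and> (x', y') \<in> quot_step S"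
  using assms(2)
proof (rule quot_stepE)
  fix r w s v assume h: "x = point S r w" "y = point S s v" "rooted r w" "rooted s v"
    "acc r s" "acc w v"
  obtain v' where v': "rooted s v'" "v \<subseteq> v'" "y' = point S s v'"
    using quot_le_up[OF S h(4)] assms(3) h(2) by blast
  obtain w' where "prime w'" "w \<subseteq> w'" "acc w' v'"
    using canonical_back_up[OF rootedD(2)[OF h(3)] rootedD(2)[OF h(4)] rootedD(2)[OF v'(1)] h(6) v'(2)]
    by blast
  then show ?thesis
    using quot_leI[OF h(3)] quot_stepI[OF _ v'(1)] rooted_mono[OF h(3)] h(1,5) v'(3) by blast
qed

text \<open>The theory found below \<open>v\<close> must still lie above the root \<open>s\<close>,
  which \<open>canonical_forth_down\<close> does not guarantee; hence the appeal to
  \<open>canonical_interpolation\<close>.\<close>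

lemma step_forth_down:
  assumes S: "finite S" and "(x, y) \<in> quot_le S" "(y, y') \<in> quot_step S"
  shows "\<exists>x'. (x, x') \<in> quot_step S \<and> (x', y') \<in> quot_le S"
  using assms(3)
proof (rule quot_stepE)
  fix r w s v assume h: "y = point S r w" "y' = point S s v" "rooted r w" "rooted s v"
    "acc r s" "acc w v"
  obtain c where c: "rooted r c" "c \<subseteq> w" "x = point S r c"
    using quot_le_down[OF S h(3)] assms(2) h(1) by blast
  obtain d where "prime d" "s \<subseteq> d" "d \<subseteq> v" "acc c d"
    using canonical_interpolation[of r c w s v] h(3-6) c(1,2) unfolding rooted_def by blast
  moreover from this have "rooted s d" using h(4) by (simp add: rooted_def)
  ultimately show ?thesis
    using quot_leI[of s d v] quot_stepI[OF c(1)] h(2,4,5) c(3) by blast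
qed

lemma quot_GS4c_frame:
  assumes S: "finite S"
  shows "GS4c_frame (quot S)"
proof -
  let ?W = "{point S r w |r w. rooted r w}"
  have "quot_le S \<subseteq> ?W \<times> ?W" unfolding quot_le_def by blast
  moreover have "refl_on ?W (quot_le S)" unfolding refl_on_def using quot_le_refl by blast
  moreover have "trans (quot_le S)"
  proof (rule transI)
    fix x y z assume "(x, y) \<in> quot_le S" and yz: "(y, z) \<in> quot_le S"
    then show "(x, z) \<in> quot_le S"
    proof (elim quot_leE[of x y])
      fix r w v assume h: "x = point S r w" "y = point S r v" "rooted r w" "rooted r v" "w \<subseteq> v"
      obtain u where "rooted r u" "v \<subseteq> u" "z = point S r u"
        using quot_le_up[OF S h(4)] yz h(2) by blast
      then show ?thesis using quot_leI[OF h(3)] h(1,5) by blast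
    qed
  qed
  moreover have "(quot_step S)\<^sup>+ \<subseteq> ?W \<times> ?W"
    by (rule trancl_subset_Sigma) (unfold quot_step_def, blast)
  \<comment> \<open>Single steps are already reflexive, so the transitive closure is a
    preorder.\<close>
  moreover have "refl_on ?W ((quot_step S)\<^sup>+)"
    unfolding refl_on_def using quot_stepI acc_refl rootedD(1,2) by blast
  ultimately have b: "bi_int_frame (quot S)"
    unfolding bi_int_frame_def preorder_on_def quot_def by simp
  \<comment> \<open>Confluence passes from single steps to their closure by completing one square
    after another.\<close>
  have "\<exists>y'. (y, y') \<in> quot_le S \<and> (x', y') \<in> (quot_step S)\<^sup>+"
    if xy: "(x, y) \<in> (quot_step S)\<^sup>+" and xx: "(x, x') \<in> quot_le S" for x x' y
    using xy
  proof (induction rule: trancl_induct)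
    case (base y)
    then show ?case using step_forth_up[OF S xx] by blast
  next
    case (step y z)
    then show ?case using step_forth_up[OF S] by (meson trancl.trancl_into_trancl)
  qed
  then have fu: "forth_up_confluent (quot S)"
    unfolding forth_up_confluent_def quot_def by simp
  have "\<exists>x'. (x, x') \<in> quot_le S \<and> (x', y') \<in> (quot_step S)\<^sup>+"
    if "(x, y) \<in> (quot_step S)\<^sup>+" "(y, y') \<in> quot_le S" for x y y'
    using that
  \<comment> \<open>Here the squares are completed from the right end, so the upper world has to
    stay arbitrary.\<close>
  proof (induction arbitrary: y' rule: trancl_induct)
    case (base y)
    then show ?case using step_back_up[OF S] by blast
  next
    case (step y z)
    then show ?case using step_back_up[OF S] by (meson trancl.trancl_into_trancl)
  qed
  then have bu: "back_up_confluent (quot S)"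
    unfolding back_up_confluent_def quot_def by simp
  have "\<exists>x'. (x, x') \<in> (quot_step S)\<^sup>+ \<and> (x', y') \<in> quot_le S"
    if yy: "(y, y') \<in> (quot_step S)\<^sup>+" and xy: "(x, y) \<in> quot_le S" for x y y'
    using yy
  proof (induction rule: trancl_induct)
    case (base y)
    then show ?case using step_forth_down[OF S xy] by blast
  next
    case (step y z)
    then show ?case using step_forth_down[OF S] by (meson trancl.trancl_into_trancl)
  qed
  then have fd: "forth_down_confluent (quot S)"
    unfolding forth_down_confluent_def quot_def by simp
  have "(y, z) \<in> quot_le S \<or> (z, y) \<in> quot_le S"
    if "(x, y) \<in> quot_le S" and xz: "(x, z) \<in> quot_le S" for x y z
    using \<open>(x, y) \<in> quot_le S\<close>
  proof (rule quot_leE)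
    fix r w v assume h: "x = point S r w" "y = point S r v" "rooted r w" "rooted r v" "w \<subseteq> v"
    obtain u where u: "rooted r u" "z = point S r u"
      using quot_le_up[OF S h(3)] xz h(1) by blast
    then show ?thesis
      using prime_upward_linear[of r v u] quot_leI h(2,4) unfolding rooted_def by blast
  qed
  then have "upward_linear (quot S)"
    unfolding upward_linear_def quot_def by simp
  then show ?thesis
    using b fu bu fd by (simp add: GS4c_frame_def infallible_def quot_def)
qed

lemma quot_valuation:
  assumes S: "finite S" shows "valuation (quot S) (quot_val S)"
proof -
  have "y \<in> quot_val S p" if "x \<in> quot_val S p" and xy: "(x, y) \<in> quot_le S" for x y p
  proof -
    obtain r w where h: "x = point S r w" "rooted r w" "Var p \<in> w \<inter> S"
      using \<open>x \<in> quot_val S p\<close> unfolding quot_val_def by blast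
    obtain v where "rooted r v" "w \<subseteq> v" "y = point S r v"
      using quot_le_up[OF S h(2)] xy h(1) by blast
    then show ?thesis using h(3) unfolding quot_val_def by blast
  qed
  then show ?thesis
    unfolding valuation_def by (auto simp: quot_def quot_val_def)
qed

section \<open>The truth lemma for the quotient\<close>

lemma acc_dia: "prime w \<Longrightarrow> acc w v \<Longrightarrow> \<^bold>\<diamond> \<psi> \<in> v \<Longrightarrow> \<^bold>\<diamond> \<psi> \<in> w"
  using thy_imp[OF prime_thy dia_4] by (auto simp: acc_def undia_def)

lemma acc_box: "prime w \<Longrightarrow> acc w v \<Longrightarrow> \<^bold>\<box> \<psi> \<in> w \<Longrightarrow> \<^bold>\<box> \<psi> \<in> v"
  using thy_imp[OF prime_thy box_4] by (auto simp: acc_def unbox_def)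

text \<open>Representatives change between steps, so only membership of formulas in \<open>S\<close>
  can be transmitted. By \<open>dia_4\<close> and \<open>box_4\<close> a step passes on the modal
  formula itself rather than its argument, and this can be iterated.\<close>

lemma quot_sq_modal:
  assumes S: "finite S" and xy: "(point S r w, y) \<in> (quot_step S)\<^sup>+"
  shows "\<exists>s v. rooted s v \<and> y = point S s v \<and>
    (\<forall>\<psi>. \<^bold>\<diamond> \<psi> \<in> v \<inter> S \<longrightarrow> \<^bold>\<diamond> \<psi> \<in> w) \<and> (\<forall>\<psi>. \<^bold>\<box> \<psi> \<in> w \<inter> S \<longrightarrow> \<^bold>\<box> \<psi> \<in> v)"
proof -
  have st: "\<exists>s v. rooted s v \<and> y = point S s v \<and>
      (\<forall>\<psi>. \<^bold>\<diamond> \<psi> \<in> v \<inter> S \<longrightarrow> \<^bold>\<diamond> \<psi> \<in> w) \<and> (\<forall>\<psi>. \<^bold>\<box> \<psi> \<in> w \<inter> S \<longrightarrow> \<^bold>\<box> \<psi> \<in> v)"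
    if "(point S r w, y) \<in> quot_step S" for r w y
    using that
  proof (rule quot_stepE)
    fix r' w' s v assume h: "point S r w = point S r' w'" "y = point S s v"
      "rooted r' w'" "rooted s v" "acc r' s" "acc w' v"
    have ws: "w \<inter> S = w' \<inter> S" by (rule point_eqD(1)[OF S h(1)])
    have "\<^bold>\<diamond> \<psi> \<in> w" if "\<^bold>\<diamond> \<psi> \<in> v \<inter> S" for \<psi>
      using acc_dia[OF rootedD(2)[OF h(3)] h(6)] that ws by blast
    moreover have "\<^bold>\<box> \<psi> \<in> v" if "\<^bold>\<box> \<psi> \<in> w \<inter> S" for \<psi>
      using acc_box[OF rootedD(2)[OF h(3)] h(6)] that ws by blast
    ultimately show ?thesis using h(2,4) by blast
  qed
  show ?thesis
    using xy
  proof (induction rule: trancl_induct)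
    case (base y)
    then show ?case by (rule st)
  next
    case (step y z)
    then obtain s v where h: "rooted s v" "y = point S s v"
      "\<forall>\<psi>. \<^bold>\<diamond> \<psi> \<in> v \<inter> S \<longrightarrow> \<^bold>\<diamond> \<psi> \<in> w" "\<forall>\<psi>. \<^bold>\<box> \<psi> \<in> w \<inter> S \<longrightarrow> \<^bold>\<box> \<psi> \<in> v" by blast
    obtain t u where "rooted t u" "z = point S t u"
      "\<forall>\<psi>. \<^bold>\<diamond> \<psi> \<in> u \<inter> S \<longrightarrow> \<^bold>\<diamond> \<psi> \<in> v" "\<forall>\<psi>. \<^bold>\<box> \<psi> \<in> v \<inter> S \<longrightarrow> \<^bold>\<box> \<psi> \<in> u"
      using st step(2) h(2) by blast
    with h show ?case by blast
  qed
qed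

lemma quot_truth:
  assumes S: "finite S" and cl: "subf_closed S"
  shows "\<psi> \<in> S \<Longrightarrow> rooted r w \<Longrightarrow> sat (quot S) (quot_val S) (point S r w) \<psi> \<longleftrightarrow> \<psi> \<in> w"
proof (induction \<psi> arbitrary: r w)
  case (Var p)
  have "point S r w \<in> quot_val S p \<longleftrightarrow> Var p \<in> w"
  proof
    assume "point S r w \<in> quot_val S p"
    then obtain r' w' where "point S r w = point S r' w'" "Var p \<in> w' \<inter> S"
      unfolding quot_val_def by blast
    then show "Var p \<in> w" using point_eqD(1)[OF S] by blast
  next
    show "Var p \<in> w \<Longrightarrow> point S r w \<in> quot_val S p"
      using Var unfolding quot_val_def by blast
  qed
  then show ?case by simp
next
  case Bot
  then show ?case by (simp add: quot_def rooted_def prime_def)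
next
  case (And \<phi> \<psi>)
  then show ?case
    using subf_closedD(1)[OF cl And.prems(1)] thy_And[OF prime_thy[OF rootedD(2)[OF And.prems(2)]]]
    by simp
next
  case (Or \<phi> \<psi>)
  then show ?case
    using subf_closedD(2)[OF cl Or.prems(1)] prime_Or[OF rootedD(2)[OF Or.prems(2)]]
    by simp
next
  case (Imp \<phi> \<psi>)
  note rw = Imp.prems(2)
  have IH: "sat (quot S) (quot_val S) (point S r v) \<phi> \<longleftrightarrow> \<phi> \<in> v"
    "sat (quot S) (quot_val S) (point S r v) \<psi> \<longleftrightarrow> \<psi> \<in> v" if "rooted r v" for v
    using Imp.IH that subf_closedD(3)[OF cl Imp.prems(1)] by blast+
  have "sat (quot S) (quot_val S) (point S r w) (\<phi> \<^bold>\<rightarrow> \<psi>) \<longleftrightarrow>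
    (\<forall>v. rooted r v \<longrightarrow> w \<subseteq> v \<longrightarrow> \<phi> \<in> v \<longrightarrow> \<psi> \<in> v)" (is "?L \<longleftrightarrow> ?R")
  proof
    show ?R if L: ?L
    proof (intro allI impI)
      fix v assume v: "rooted r v" "w \<subseteq> v" "\<phi> \<in> v"
      have "(point S r w, point S r v) \<in> le (quot S)"
        using quot_leI[OF rw v(1,2)] by (simp add: quot_def)
      then show "\<psi> \<in> v" using L IH[OF v(1)] v(3) by simp
    qed
    show ?L if R: ?R
      unfolding sat.simps
    proof (intro allI impI)
      fix y assume y: "(point S r w, y) \<in> le (quot S)" "sat (quot S) (quot_val S) y \<phi>"
      then obtain v where v: "rooted r v" "w \<subseteq> v" "y = point S r v"
        using quot_le_up[OF S rw, of y] by (auto simp: quot_def)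
      then show "sat (quot S) (quot_val S) y \<psi>" using R IH[OF v(1)] y(2) by blast
    qed
  qed
  \<comment> \<open>Every prime theory above \<open>w\<close> is above \<open>r\<close> as well, so
    the root does not restrict the quantifier.\<close>
  also have "\<dots> \<longleftrightarrow> \<phi> \<^bold>\<rightarrow> \<psi> \<in> w"
    using prime_Imp[OF prime_thy[OF rootedD(2)[OF rw]]] rw rooted_mono[OF rw] rootedD(2) by blast
  finally show ?case .
next
  case (Dia \<psi>)
  note rw = Dia.prems(2)
  note F = quot_GS4c_frame[OF S] and V = quot_valuation[OF S]
  have \<psi>: "\<psi> \<in> S" by (rule subf_closedD(4)[OF cl Dia.prems(1)])
  have W: "point S r w \<in> worlds (quot S)" using rw by (auto simp: quot_def)
  have "(\<exists>y. (point S r w, y) \<in> sq (quot S) \<and> sat (quot S) (quot_val S) y \<psi>) \<longleftrightarrow> \<^bold>\<diamond> \<psi> \<in> w"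
  proof
    assume "\<exists>y. (point S r w, y) \<in> sq (quot S) \<and> sat (quot S) (quot_val S) y \<psi>"
    then obtain y where y: "(point S r w, y) \<in> (quot_step S)\<^sup>+" "sat (quot S) (quot_val S) y \<psi>"
      by (auto simp: quot_def)
    from quot_sq_modal[OF S y(1)] obtain s v where v: "rooted s v" "y = point S s v"
      "\<^bold>\<diamond> \<psi> \<in> v \<inter> S \<longrightarrow> \<^bold>\<diamond> \<psi> \<in> w" by blast
    have "\<psi> \<in> v" using Dia.IH[OF \<psi> v(1)] y(2) v(2) by simp
    then show "\<^bold>\<diamond> \<psi> \<in> w"
      using v(3) Dia.prems(1) thy_imp[OF prime_thy[OF rootedD(2)[OF v(1)]] dia_T] by blast
  next
    assume "\<^bold>\<diamond> \<psi> \<in> w"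
    then obtain v where v: "prime v" "acc w v" "\<psi> \<in> v"
      using canonical_dia[OF rootedD(2)[OF rw]] by blast
    \<comment> \<open>The witness \<open>v\<close> needs a root of its own that is accessible from
      \<open>r\<close>; forth-down confluence applied to \<open>r \<subseteq> w\<close> finds it
      below \<open>v\<close>.\<close>
    then obtain s where "prime s" "acc r s" "s \<subseteq> v"
      using canonical_forth_down[OF rootedD(1,2)[OF rw] v(1) rootedD(3)[OF rw] v(2)] by blast
    with v have s: "rooted s v" "acc r s" by (auto simp: rooted_def)
    have "(point S r w, point S s v) \<in> sq (quot S)"
      using quot_stepI[OF rw s v(2)] by (auto simp: quot_def)
    then show "\<exists>y. (point S r w, y) \<in> sq (quot S) \<and> sat (quot S) (quot_val S) y \<psi>"
      using Dia.IH[OF \<psi> s(1)] v(3) by blast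
  qed
  then show ?case using sat_Dia_iff[OF F V W] by blast
next
  case (Box \<psi>)
  note rw = Box.prems(2)
  note F = quot_GS4c_frame[OF S] and V = quot_valuation[OF S]
  have \<psi>: "\<psi> \<in> S" by (rule subf_closedD(5)[OF cl Box.prems(1)])
  have W: "point S r w \<in> worlds (quot S)" using rw by (auto simp: quot_def)
  have "(\<forall>y. (point S r w, y) \<in> sq (quot S) \<longrightarrow> sat (quot S) (quot_val S) y \<psi>) \<longleftrightarrow> \<^bold>\<box> \<psi> \<in> w"
  proof
    assume h: "\<forall>y. (point S r w, y) \<in> sq (quot S) \<longrightarrow> sat (quot S) (quot_val S) y \<psi>"
    show "\<^bold>\<box> \<psi> \<in> w"
    proof (rule ccontr)
      assume "\<^bold>\<box> \<psi> \<notin> w"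
      then obtain v where v: "prime v" "acc w v" "\<psi> \<notin> v"
        using canonical_box[OF rootedD(2)[OF rw]] by blast
      then obtain s where "prime s" "acc r s" "s \<subseteq> v"
        using canonical_forth_down[OF rootedD(1,2)[OF rw] v(1) rootedD(3)[OF rw] v(2)] by blast
      with v have s: "rooted s v" "acc r s" by (auto simp: rooted_def)
      have "(point S r w, point S s v) \<in> sq (quot S)"
        using quot_stepI[OF rw s v(2)] by (auto simp: quot_def)
      then show False
        using Box.IH[OF \<psi> s(1)] v(3) h by blast
    qed
  next
    assume b: "\<^bold>\<box> \<psi> \<in> w"
    show "\<forall>y. (point S r w, y) \<in> sq (quot S) \<longrightarrow> sat (quot S) (quot_val S) y \<psi>"
    proof (intro allI impI)
      fix y assume "(point S r w, y) \<in> sq (quot S)"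
      then have "(point S r w, y) \<in> (quot_step S)\<^sup>+" by (simp add: quot_def)
      from quot_sq_modal[OF S this] obtain s v where v: "rooted s v" "y = point S s v"
        "\<^bold>\<box> \<psi> \<in> w \<inter> S \<longrightarrow> \<^bold>\<box> \<psi> \<in> v" by blast
      then have "\<psi> \<in> v"
        using b Box.prems(1) thy_imp[OF prime_thy[OF rootedD(2)[OF v(1)]] box_T] by blast
      then show "sat (quot S) (quot_val S) y \<psi>" using Box.IH[OF \<psi> v(1)] v(2) by simp
    qed
  qed
  then show ?case using sat_Box_iff[OF F V W] by blast
qed

text \<open>The bound of \<open>point_less\<close> with \<open>n = Suc c\<close>, since codes of
  subformulas are at most \<open>c\<close>.\<close>

definition world_bound :: "nat \<Rightarrow> nat" where
  "world_bound c = Suc (prod_encode (2 ^ 2 ^ Suc c, 2 ^ Suc c))"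

theorem GS4c_bounded_countermodel:
  assumes "\<phi> \<notin> GS4c"
  obtains F :: "nat frame" where "GS4c_frame F" "worlds F \<subseteq> {..<world_bound (fm_code \<phi>)}"
    "falsifiable_on F \<phi>"
proof -
  let ?S = "subf \<phi>"
  obtain w where w: "prime w" "\<phi> \<notin> w" using prime_avoiding[OF thy_GS4c assms] by blast
  then have ww: "rooted w w" by (simp add: rooted_def)
  have "\<not> sat (quot ?S) (quot_val ?S) (point ?S w w) \<phi>"
    using quot_truth[OF finite_subf subf_closed_subf subf_self ww] w(2) by blast
  moreover have "point ?S w w \<in> worlds (quot ?S) - fallible (quot ?S)"
    using ww by (auto simp: quot_def)
  ultimately have "falsifiable_on (quot ?S) \<phi>"
    using quot_valuation[OF finite_subf] unfolding falsifiable_on_def by blast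
  moreover have "fm_code ` ?S \<subseteq> {..<Suc (fm_code \<phi>)}"
    using fm_code_subf by (auto simp: less_Suc_eq_le)
  then have "worlds (quot ?S) \<subseteq> {..<world_bound (fm_code \<phi>)}"
    using point_less[of ?S "Suc (fm_code \<phi>)"] unfolding world_bound_def quot_def frame.simps
    by blast
  ultimately show ?thesis using that[OF quot_GS4c_frame[OF finite_subf]] by blast
qed

section \<open>Recursive functions\<close>

text \<open>The predicate \<^const>\<open>recursive_fun\<close> distinguishes functions that differ only on argument
  lists of the wrong length.\<close>

definition recf :: "nat \<Rightarrow> (nat list \<Rightarrow> nat) \<Rightarrow> bool" where
  "recf n f \<longleftrightarrow> (\<exists>g. recursive_fun n g \<and> (\<forall>xs. length xs = n \<longrightarrow> g xs = f xs))"

lemma recf_cong: "recf n f \<Longrightarrow> (\<And>xs. length xs = n \<Longrightarrow> f xs = g xs) \<Longrightarrow> recf n g"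
  unfolding recf_def by metis

lemma recfI: "recursive_fun n f \<Longrightarrow> recf n f"
  unfolding recf_def by blast

lemma recf_nth: "i < n \<Longrightarrow> recf n (\<lambda>xs. xs ! i)"
  by (intro recfI recursive_fun.proj)

lemma recf_comp:
  assumes "recf (length fs) h" and "\<And>f. f \<in> set fs \<Longrightarrow> recf n f"
  shows "recf n (\<lambda>xs. h (map (\<lambda>f. f xs) fs))"
proof -
  obtain h' where h': "recursive_fun (length fs) h'" "\<And>xs. length xs = length fs \<Longrightarrow> h' xs = h xs"
    using assms(1) unfolding recf_def by blast
  obtain G where G: "\<And>f. f \<in> set fs \<Longrightarrow> recursive_fun n (G f) \<and> (\<forall>xs. length xs = n \<longrightarrow> G f xs = f xs)"
    using assms(2) unfolding recf_def by metis
  have "recursive_fun n (\<lambda>xs. h' (map (\<lambda>g. g xs) (map G fs)))"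
    by (rule recursive_fun.comp) (use h'(1) G in auto)
  moreover have "h' (map (\<lambda>g. g xs) (map G fs)) = h (map (\<lambda>f. f xs) fs)" if "length xs = n" for xs
  proof -
    have "map (\<lambda>g. g xs) (map G fs) = map (\<lambda>f. f xs) fs" using G that by simp
    then show ?thesis using h'(2)[of "map (\<lambda>f. f xs) fs"] by (metis length_map)
  qed
  ultimately show ?thesis unfolding recf_def by blast
qed

lemma recf_comp1:
  assumes "recf 1 (\<lambda>xs. h (xs ! 0))" "recf n f"
  shows "recf n (\<lambda>xs. h (f xs))"
  using recf_comp[of "[f]" "\<lambda>xs. h (xs ! 0)" n] assms by simp

lemma recf_comp2:
  assumes "recf 2 (\<lambda>xs. h (xs ! 0) (xs ! 1))" "recf n f" "recf n g"
  shows "recf n (\<lambda>xs. h (f xs) (g xs))"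
  using recf_comp[of "[f, g]" "\<lambda>xs. h (xs ! 0) (xs ! 1)" n] assms by (auto simp: numeral_2_eq_2)

lemma recf_prim_rec:
  assumes "recf n f" "recf (Suc (Suc n)) g"
  shows "recf (Suc n) (\<lambda>xs. rec_nat (f (tl xs)) (\<lambda>y r. g (y # r # tl xs)) (hd xs))"
proof -
  obtain f' where f': "recursive_fun n f'" "\<And>xs. length xs = n \<Longrightarrow> f' xs = f xs"
    using assms(1) unfolding recf_def by blast
  obtain g' where g': "recursive_fun (Suc (Suc n)) g'" "\<And>xs. length xs = Suc (Suc n) \<Longrightarrow> g' xs = g xs"
    using assms(2) unfolding recf_def by blast
  have "rec_nat (f' (tl xs)) (\<lambda>y r. g' (y # r # tl xs)) k = rec_nat (f (tl xs)) (\<lambda>y r. g (y # r # tl xs)) k"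
    if "length xs = Suc n" for xs k
    by (induction k) (use that f'(2) g'(2) in auto)
  then show ?thesis
    using recursive_fun.prim_rec[OF f'(1) g'(1)] unfolding recf_def by blast
qed

lemma recf_rec1:
  assumes "recf 2 (\<lambda>xs. g (xs ! 0) (xs ! 1))" and "h 0 = a" and "\<And>y. h (Suc y) = g y (h y)"
  shows "recf 1 (\<lambda>xs. h (xs ! 0))"
proof -
  have h: "h k = rec_nat a (\<lambda>y r. g y r) k" for k
    by (induction k) (use assms(2,3) in auto)
  have "recf 0 (\<lambda>xs. a)"
  proof (induction a)
    case (Suc a)
    have "recf 1 (\<lambda>xs. Suc (xs ! 0))" by (intro recfI recursive_fun.succ)
    then show ?case using recf_comp1 Suc by blast
  qed (intro recfI recursive_fun.zero)
  then have "recf (Suc 0) (\<lambda>xs. rec_nat a (\<lambda>y r. g ((y # r # tl xs) ! 0) ((y # r # tl xs) ! 1)) (hd xs))"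
    by (rule recf_prim_rec) (use assms(1) in \<open>simp add: numeral_2_eq_2\<close>)
  then show ?thesis
    unfolding One_nat_def by (rule recf_cong) (auto simp: h length_Suc_conv)
qed

text \<open>The step does not receive the parameter, which is enough for addition, subtraction and
  iterated halving. Multiplication adds the parameter at each step and goes through
  \<open>recf_prim_rec\<close> directly.\<close>

lemma recf_rec2:
  assumes "recf 1 (\<lambda>xs. f (xs ! 0))" and "recf 2 (\<lambda>xs. g (xs ! 0) (xs ! 1))"
    and "\<And>x. h 0 x = f x" and "\<And>y x. h (Suc y) x = g y (h y x)"
  shows "recf 2 (\<lambda>xs. h (xs ! 0) (xs ! 1))"
proof -
  have h: "h k x = rec_nat (f x) (\<lambda>y r. g y r) k" for k x
    by (induction k) (use assms(3,4) in auto)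
  have "recf (Suc (Suc 1)) (\<lambda>xs. g (xs ! 0) (xs ! 1))"
    by (rule recf_comp2[OF assms(2)]) (auto intro!: recf_nth)
  then have "recf (Suc 1) (\<lambda>xs. rec_nat (f (tl xs ! 0))
      (\<lambda>y r. g ((y # r # tl xs) ! 0) ((y # r # tl xs) ! 1)) (hd xs))"
    by (rule recf_prim_rec[OF assms(1)])
  then show ?thesis
    unfolding numeral_2_eq_2 One_nat_def
    by (rule recf_cong) (auto simp: h length_Suc_conv)
qed

section \<open>Arithmetic functions and pairing\<close>

lemma recf_Suc: "recf n f \<Longrightarrow> recf n (\<lambda>xs. Suc (f xs))"
  by (rule recf_comp1[of Suc]) (intro recfI recursive_fun.succ)

lemma recf_const: "recf n (\<lambda>xs. k)"
proof (induction k)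
  case 0
  show ?case by (intro recfI recursive_fun.zero)
qed (rule recf_Suc)

lemma recf_add: "recf n f \<Longrightarrow> recf n g \<Longrightarrow> recf n (\<lambda>xs. f xs + g xs)"
  by (rule recf_comp2[of "(+)"], rule recf_rec2[of "\<lambda>x. x" "\<lambda>y r. Suc r" "(+)"])
    (auto intro!: recf_nth recf_Suc)

lemma recf_mult: "recf n f \<Longrightarrow> recf n g \<Longrightarrow> recf n (\<lambda>xs. f xs * g xs)"
proof (rule recf_comp2[of "(*)"])
  have "recf 3 (\<lambda>xs. xs ! 2 + xs ! 1)"
    by (intro recf_add recf_nth) auto
  then have "recf (Suc 1) (\<lambda>xs. rec_nat 0 (\<lambda>y r. (y # r # tl xs) ! 2 + (y # r # tl xs) ! 1) (hd xs))"
    by (intro recf_prim_rec[OF recf_const]) (simp add: numeral_3_eq_3)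
  moreover have "rec_nat 0 (\<lambda>y r. x + r) k = k * x" for k x :: nat
    by (induction k) auto
  ultimately show "recf 2 (\<lambda>xs. xs ! 0 * xs ! 1)"
    unfolding numeral_2_eq_2 One_nat_def
    by (elim recf_cong) (auto simp: length_Suc_conv)
qed

text \<open>The recursion runs over the subtrahend and iterates the predecessor, hence the swapped
  arguments.\<close>

lemma recf_diff: "recf n f \<Longrightarrow> recf n g \<Longrightarrow> recf n (\<lambda>xs. f xs - g xs)"
proof (rule recf_comp2[of "\<lambda>y x. x - y"])
  have "recf 1 (\<lambda>xs. xs ! 0 - 1)"
    by (rule recf_rec1[of "\<lambda>y r. y" "\<lambda>x. x - 1"]) (auto intro!: recf_nth)
  then have "recf 2 (\<lambda>xs. xs ! 1 - 1)"
    by (rule recf_comp1[of "\<lambda>x. x - 1"]) (simp add: recf_nth)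
  then show "recf 2 (\<lambda>xs. xs ! 1 - xs ! 0)"
    by (intro recf_rec2[of "\<lambda>x. x" "\<lambda>y r. r - 1" "\<lambda>y x. x - y"]) (auto intro!: recf_nth)
qed

lemma recf_power2: "recf n f \<Longrightarrow> recf n (\<lambda>xs. 2 ^ f xs)"
  by (rule recf_comp1[of "\<lambda>x. 2 ^ x"], rule recf_rec1[of "\<lambda>y r. r + r" "\<lambda>x. 2 ^ x"])
    (auto intro!: recf_add recf_nth)

lemma recf_triangle: "recf n f \<Longrightarrow> recf n (\<lambda>xs. triangle (f xs))"
  by (rule recf_comp1[of triangle], rule recf_rec1[of "\<lambda>y r. r + Suc y" triangle])
    (auto intro!: recf_add recf_Suc recf_nth)

lemma recf_prod_encode: "recf n f \<Longrightarrow> recf n g \<Longrightarrow> recf n (\<lambda>xs. prod_encode (f xs, g xs))"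
  unfolding prod_encode_def by (auto intro!: recf_add recf_triangle)

lemma recf_div2: "recf n f \<Longrightarrow> recf n (\<lambda>xs. f xs div 2)"
proof (rule recf_comp1[of "\<lambda>x. x div 2"])
  \<comment> \<open>Expresses the next half through the counter and the previous half, the only data
    available to the step.\<close>
  have "Suc y div 2 = y - y div 2" for y :: nat by presburger
  then show "recf 1 (\<lambda>xs. xs ! 0 div 2)"
    by (intro recf_rec1[of "\<lambda>y r. y - r" "\<lambda>x. x div 2"]) (auto intro!: recf_diff recf_nth)
qed

lemma recf_mod2: "recf n f \<Longrightarrow> recf n (\<lambda>xs. f xs mod 2)"
proof (rule recf_comp1[of "\<lambda>x. x mod 2"])
  have "Suc y mod 2 = 1 - y mod 2" for y :: nat by presburger
  then show "recf 1 (\<lambda>xs. xs ! 0 mod 2)"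
    by (intro recf_rec1[of "\<lambda>y r. 1 - r" "\<lambda>x. x mod 2"]) (auto intro!: recf_diff recf_nth recf_const)
qed

text \<open>Membership in a decoded set is a bit test: iterated halving followed by parity.\<close>

lemma recf_set_decode:
  assumes "recf n f" "recf n g"
  shows "recf n (\<lambda>xs. of_bool (f xs \<in> set_decode (g xs)))"
proof -
  have "recf 2 (\<lambda>xs. xs ! 1 div 2 ^ (xs ! 0))"
  proof (rule recf_rec2[of "\<lambda>x. x" "\<lambda>y r. r div 2" "\<lambda>y x. x div 2 ^ y"])
    show "x div 2 ^ Suc y = x div 2 ^ y div 2" for x y :: nat
      by (metis div_mult2_eq power_Suc2)
  qed (auto intro!: recf_nth recf_div2)
  then have "recf n (\<lambda>xs. g xs div 2 ^ f xs mod 2)"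
    by (intro recf_mod2 recf_comp2[of "\<lambda>y x. x div 2 ^ y", OF _ assms])
  then show ?thesis
    by (rule recf_cong) (simp add: set_decode_def of_bool_odd_eq_mod_2)
qed

section \<open>Recursive predicates as functions with values 0 and 1\<close>

lemma recf_not: "recf n (\<lambda>xs. of_bool (P xs)) \<Longrightarrow> recf n (\<lambda>xs. of_bool (\<not> P xs))"
  by (rule recf_cong[OF recf_diff[OF recf_const[of n 1]]]) auto

lemma recf_conj: "recf n (\<lambda>xs. of_bool (P xs)) \<Longrightarrow> recf n (\<lambda>xs. of_bool (Q xs)) \<Longrightarrow>
    recf n (\<lambda>xs. of_bool (P xs \<and> Q xs))"
  by (drule (1) recf_mult) (simp add: of_bool_conj)

text \<open>The truth value of a bounded universal statement is the product of the truth values of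
  its instances, accumulated by primitive recursion.\<close>

lemma recf_ball:
  assumes P: "recf (Suc n) (\<lambda>xs. of_bool (P (hd xs) (tl xs)))" and b: "recf n b"
  shows "recf n (\<lambda>xs. of_bool (\<forall>i<b xs. P i xs))"
proof -
  have "recf (Suc (Suc n)) (\<lambda>xs. of_bool (P (xs ! 0) (tl (tl xs))))"
  proof -
    \<comment> \<open>The step function gets the counter, the product so far and the parameters;
      these projections drop the second entry, which \<open>P\<close> does not expect.\<close>
    let ?fs = "(\<lambda>xs. xs ! 0) # map (\<lambda>i xs. xs ! Suc (Suc i)) [0..<n]"
    have "recf (Suc (Suc n)) (\<lambda>xs. of_bool (P (hd (map (\<lambda>f. f xs) ?fs)) (tl (map (\<lambda>f. f xs) ?fs))))"
      by (rule recf_comp[of ?fs]) (use P in \<open>auto intro!: recf_nth\<close>)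
    then show ?thesis
    proof (rule recf_cong)
      fix xs :: "nat list" assume l: "length xs = Suc (Suc n)"
      have "map (\<lambda>i. xs ! Suc (Suc i)) [0..<n] = tl (tl xs)"
        by (rule nth_equalityI) (use l in \<open>auto simp: nth_tl\<close>)
      then show "of_bool (P (hd (map (\<lambda>f. f xs) ?fs)) (tl (map (\<lambda>f. f xs) ?fs))) =
        (of_bool (P (xs ! 0) (tl (tl xs))) :: nat)" by (simp add: comp_def)
    qed
  qed
  then have "recf (Suc (Suc n)) (\<lambda>xs. xs ! 1 * of_bool (P (xs ! 0) (tl (tl xs))))"
    by (intro recf_mult recf_nth) auto
  then have r: "recf (Suc n) (\<lambda>xs. rec_nat 1 (\<lambda>y r. (y # r # tl xs) ! 1 *
      of_bool (P ((y # r # tl xs) ! 0) (tl (tl (y # r # tl xs))))) (hd xs))"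
    by (rule recf_prim_rec[OF recf_const])
  have e: "rec_nat 1 (\<lambda>y r. r * of_bool (P y xs)) k = (of_bool (\<forall>i<k. P i xs) :: nat)" for xs k
    by (induction k) (auto simp: less_Suc_eq)
  have q: "recf (Suc n) (\<lambda>xs. of_bool (\<forall>i<hd xs. P i (tl xs)))"
    by (rule recf_cong[OF r]) (simp add: e[symmetric])
  \<comment> \<open>Inserts the bound, itself a function of the parameters, as the recursion
    argument.\<close>
  let ?gs = "b # map (\<lambda>i xs. xs ! i) [0..<n]"
  have "recf n (\<lambda>xs. of_bool (\<forall>i<hd (map (\<lambda>f. f xs) ?gs). P i (tl (map (\<lambda>f. f xs) ?gs))))"
    by (rule recf_comp[of ?gs]) (use q b in \<open>auto intro!: recf_nth\<close>)
  then show ?thesis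
  proof (rule recf_cong)
    fix xs :: "nat list" assume "length xs = n"
    then have "map ((!) xs) [0..<n] = xs" using map_nth by blast
    then show "of_bool (\<forall>i<hd (map (\<lambda>f. f xs) ?gs). P i (tl (map (\<lambda>f. f xs) ?gs))) =
      (of_bool (\<forall>i<b xs. P i xs) :: nat)" by (simp add: comp_def)
  qed
qed

section \<open>Bounded formulas over a coded structure\<close>

text \<open>A single number holds several finite binary relations at once, distinguished by the tag
  \<open>k\<close>.\<close>

definition coded :: "nat \<Rightarrow> nat \<Rightarrow> nat \<Rightarrow> nat \<Rightarrow> bool" where
  "coded y k a b \<longleftrightarrow> prod_encode (k, prod_encode (a, b)) \<in> set_decode y"

datatype tm = TV nat | TK nat | TP tm tm

text \<open>With a syntax for bounded predicates, recursiveness is one induction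
  (\<open>recf_bev\<close>), and the countermodel condition only has to be written down as a
  term.\<close>

datatype bf = Rel nat tm tm | BNot bf | BAnd bf bf | BAll nat bf

primrec tev :: "(nat \<Rightarrow> nat) \<Rightarrow> tm \<Rightarrow> nat" where
  "tev e (TV i) = e i"
| "tev e (TK k) = k"
| "tev e (TP s t) = prod_encode (tev e s, tev e t)"

text \<open>Variable 0 holds the code of the structure, which also bounds all quantifiers.\<close>

primrec bev :: "(nat \<Rightarrow> nat) \<Rightarrow> bf \<Rightarrow> bool" where
  "bev e (Rel k s t) \<longleftrightarrow> coded (e 0) k (tev e s) (tev e t)"
| "bev e (BNot f) \<longleftrightarrow> \<not> bev e f"
| "bev e (BAnd f g) \<longleftrightarrow> bev e f \<and> bev e g"
| "bev e (BAll v f) \<longleftrightarrow> (\<forall>i<e 0. bev (e(v := i)) f)"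

primrec twf :: "nat \<Rightarrow> tm \<Rightarrow> bool" where
  "twf n (TV i) \<longleftrightarrow> i < n"
| "twf n (TK k) \<longleftrightarrow> True"
| "twf n (TP s t) \<longleftrightarrow> twf n s \<and> twf n t"

primrec bwf :: "nat \<Rightarrow> bf \<Rightarrow> bool" where
  "bwf n (Rel k s t) \<longleftrightarrow> twf n s \<and> twf n t"
| "bwf n (BNot f) \<longleftrightarrow> bwf n f"
| "bwf n (BAnd f g) \<longleftrightarrow> bwf n f \<and> bwf n g"
| "bwf n (BAll v f) \<longleftrightarrow> v < n \<and> bwf n f"

abbreviation "BImp f g \<equiv> BNot (BAnd f (BNot g))"
abbreviation "BOr f g \<equiv> BNot (BAnd (BNot f) (BNot g))"
abbreviation "BIff f g \<equiv> BAnd (BImp f g) (BImp g f)"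
abbreviation "BEx v f \<equiv> BNot (BAll v (BNot f))"

lemma recf_tev: "twf n t \<Longrightarrow> recf n (\<lambda>xs. tev ((!) xs) t)"
  by (induction t) (auto intro!: recf_nth recf_const recf_prod_encode)

lemma recf_bev: "0 < n \<Longrightarrow> bwf n f \<Longrightarrow> recf n (\<lambda>xs. of_bool (bev ((!) xs) f))"
proof (induction f)
  case (Rel k s t)
  then show ?case
    unfolding bev.simps coded_def
    by (intro recf_set_decode recf_prod_encode recf_tev recf_const recf_nth) auto
next
  case (BAll v f)
  \<comment> \<open>\<open>recf_ball\<close> delivers the quantified value in front of the
    environment; this moves it to position \<open>v\<close> and shifts the other entries
    back.\<close>
  let ?fs = "map (\<lambda>i xs. xs ! (if i = v then 0 else Suc i)) [0..<n]"
  have "recf (Suc n) (\<lambda>xs. of_bool (bev ((!) (map (\<lambda>f. f xs) ?fs)) f))"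
    by (rule recf_comp[of ?fs]) (use BAll in \<open>auto intro!: recf_nth\<close>)
  then have "recf (Suc n) (\<lambda>xs. of_bool (bev (((!) (tl xs))(v := hd xs)) f))"
  proof (rule recf_cong)
    fix xs :: "nat list" assume l: "length xs = Suc n"
    have "map (\<lambda>f. f xs) ?fs = (tl xs)[v := hd xs]"
      by (rule nth_equalityI) (use l in \<open>auto simp: nth_list_update length_Suc_conv\<close>)
    moreover have "(!) ((tl xs)[v := hd xs]) = ((!) (tl xs))(v := hd xs)"
      using l BAll.prems(2) by (auto simp: fun_eq_iff)
    ultimately show "of_bool (bev ((!) (map (\<lambda>f. f xs) ?fs)) f) =
      (of_bool (bev (((!) (tl xs))(v := hd xs)) f) :: nat)" by simp
  qed
  then show ?case
    unfolding bev.simps by (rule recf_ball) (use BAll.prems(1) in \<open>rule recf_nth\<close>)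
qed (auto intro!: recf_not recf_conj)

section \<open>Decidability\<close>

text \<open>The numbers 0 to 4 code, in this order, the worlds, the intuitionistic order, the accessibility
  relation, the truth relation between worlds and formula codes, and the set of codes of relevant
  formulas. Worlds and relevant formulas are unary, with a dummy second argument 0.\<close>

abbreviation "bW t \<equiv> Rel 0 t (TK 0)"
abbreviation "bLe \<equiv> Rel 1"
abbreviation "bSq \<equiv> Rel 2"
abbreviation "bT \<equiv> Rel 3"
abbreviation "bS t \<equiv> Rel 4 t (TK 0)"

section \<open>The bounded formula that describes a countermodel\<close>

definition preorder_bf :: "nat \<Rightarrow> bf" where
  "preorder_bf k =
    BAnd (BAll 2 (BAll 3 (BImp (Rel k (TV 2) (TV 3)) (BAnd (bW (TV 2)) (bW (TV 3))))))
    (BAnd (BAll 2 (BImp (bW (TV 2)) (Rel k (TV 2) (TV 2))))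
    (BAll 2 (BAll 3 (BAll 4 (BImp (Rel k (TV 2) (TV 3))
      (BImp (Rel k (TV 3) (TV 4)) (Rel k (TV 2) (TV 4))))))))"

definition confluence_bf :: bf where
  "confluence_bf =
    BAnd (BAll 2 (BAll 3 (BAll 4 (BImp (bLe (TV 2) (TV 3)) (BImp (bSq (TV 2) (TV 4))
      (BEx 5 (BAnd (bLe (TV 4) (TV 5)) (bSq (TV 3) (TV 5)))))))))
    (BAnd (BAll 2 (BAll 3 (BAll 4 (BImp (bSq (TV 2) (TV 3)) (BImp (bLe (TV 3) (TV 4))
      (BEx 5 (BAnd (bLe (TV 2) (TV 5)) (bSq (TV 5) (TV 4)))))))))
    (BAnd (BAll 2 (BAll 3 (BAll 4 (BImp (bLe (TV 2) (TV 3)) (BImp (bSq (TV 3) (TV 4))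
      (BEx 5 (BAnd (bSq (TV 2) (TV 5)) (bLe (TV 5) (TV 4)))))))))
    (BAll 2 (BAll 3 (BAll 4 (BImp (bLe (TV 2) (TV 3)) (BImp (bLe (TV 2) (TV 4))
      (BOr (bLe (TV 3) (TV 4)) (bLe (TV 4) (TV 3))))))))))"

text \<open>\<open>k\<close> is the tag of a connective in \<open>fm_code\<close>, and
  \<open>f\<close> is its satisfaction clause, with the world in variable 2 and the codes of the
  arguments in 3 and 4. Demanding \<open>bS\<close> of the arguments closes the relevant formulas
  under subformulas.\<close>

definition binary_bf :: "nat \<Rightarrow> bf \<Rightarrow> bf" where
  "binary_bf k f = BAll 3 (BAll 4 (BImp (bS (TP (TK k) (TP (TV 3) (TV 4))))
    (BAnd (bS (TV 3)) (BAnd (bS (TV 4))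
    (BAll 2 (BImp (bW (TV 2)) (BIff (bT (TV 2) (TP (TK k) (TP (TV 3) (TV 4)))) f)))))))"

definition unary_bf :: "nat \<Rightarrow> bf \<Rightarrow> bf" where
  "unary_bf k f = BAll 3 (BImp (bS (TP (TK k) (TV 3)))
    (BAnd (bS (TV 3)) (BAll 2 (BImp (bW (TV 2)) (BIff (bT (TV 2) (TP (TK k) (TV 3))) f)))))"

text \<open>Truth is part of the coded structure and is merely checked clause by clause, so
  evaluating formulas requires no recursion. On variables it acts as the valuation, whence
  persistence is the only demand there.\<close>

definition truth_bf :: bf where
  "truth_bf =
    BAnd (BAll 3 (BImp (bS (TP (TK 0) (TV 3)))
      (BAll 2 (BAll 4 (BImp (bLe (TV 2) (TV 4))
        (BImp (bT (TV 2) (TP (TK 0) (TV 3))) (bT (TV 4) (TP (TK 0) (TV 3)))))))))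
    (BAnd (BImp (bS (TP (TK 1) (TK 0))) (BAll 2 (BNot (bT (TV 2) (TP (TK 1) (TK 0))))))
    (BAnd (binary_bf 2 (BAnd (bT (TV 2) (TV 3)) (bT (TV 2) (TV 4))))
    (BAnd (binary_bf 3 (BOr (bT (TV 2) (TV 3)) (bT (TV 2) (TV 4))))
    (BAnd (binary_bf 4 (BAll 5 (BImp (bLe (TV 2) (TV 5)) (BImp (bT (TV 5) (TV 3)) (bT (TV 5) (TV 4))))))
    (BAnd (unary_bf 5 (BAll 5 (BImp (bLe (TV 2) (TV 5)) (BEx 6 (BAnd (bSq (TV 5) (TV 6)) (bT (TV 6) (TV 3)))))))
    (unary_bf 6 (BAll 5 (BImp (bLe (TV 2) (TV 5)) (BAll 6 (BImp (bSq (TV 5) (TV 6)) (bT (TV 6) (TV 3))))))))))))"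

definition countermodel_bf :: bf where
  "countermodel_bf = BAnd (preorder_bf 1) (BAnd (preorder_bf 2) (BAnd confluence_bf (BAnd truth_bf
    (BAnd (bS (TV 1)) (BEx 2 (BAnd (bW (TV 2)) (BNot (bT (TV 2) (TV 1)))))))))"

lemma bwf_countermodel_bf: "bwf 7 countermodel_bf"
  by (simp add: countermodel_bf_def preorder_bf_def confluence_bf_def truth_bf_def
      binary_bf_def unary_bf_def)

lemma in_set_decode_less: "n \<in> set_decode y \<Longrightarrow> n < y"
proof -
  assume "n \<in> set_decode y"
  then have "y div 2 ^ n \<noteq> 0" by (auto simp: set_decode_def intro: Nat.gr0I)
  then have "2 ^ n \<le> y" by (simp add: div_eq_0_iff)
  then show "n < y" using less_exp[of n] by linarith
qed

text \<open>Components of a coded triple are smaller than the code. A quantifier bounded by the code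
  thus loses nothing once its variable is guarded by a coded atom.\<close>

lemma coded_less:
  assumes "coded y k a b" shows "a < y" "b < y"
proof -
  have "prod_encode (k, prod_encode (a, b)) < y"
    using assms in_set_decode_less by (simp add: coded_def)
  then show "a < y" "b < y"
    using le_prod_encode_1[of a b] le_prod_encode_2[of b a]
      le_prod_encode_2[of "prod_encode (a, b)" k] by linarith+
qed

text \<open>The truth of \<^const>\<open>countermodel_bf\<close>, with the bounds on the quantifiers dropped.\<close>

locale coded_countermodel =
  fixes W :: "nat \<Rightarrow> bool" and L R T :: "nat \<Rightarrow> nat \<Rightarrow> bool" and S :: "nat \<Rightarrow> bool" and c :: nat
  assumes le_W: "L a b \<Longrightarrow> W a \<and> W b" and le_refl: "W a \<Longrightarrow> L a a"
    and le_trans: "L a b \<Longrightarrow> L b d \<Longrightarrow> L a d"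
    and sq_W: "R a b \<Longrightarrow> W a \<and> W b" and sq_refl: "W a \<Longrightarrow> R a a"
    and sq_trans: "R a b \<Longrightarrow> R b d \<Longrightarrow> R a d"
    and forth_up: "L a b \<Longrightarrow> R a d \<Longrightarrow> \<exists>e. L d e \<and> R b e"
    and back_up: "R a b \<Longrightarrow> L b d \<Longrightarrow> \<exists>e. L a e \<and> R e d"
    and forth_down: "L a b \<Longrightarrow> R b d \<Longrightarrow> \<exists>e. R a e \<and> L e d"
    and linear: "L a b \<Longrightarrow> L a d \<Longrightarrow> L b d \<or> L d b"
    and Var: "S (prod_encode (0, p)) \<Longrightarrow> L a b \<Longrightarrow> T a (prod_encode (0, p)) \<Longrightarrow> T b (prod_encode (0, p))"
    and Bot: "S (prod_encode (1, 0)) \<Longrightarrow> \<not> T a (prod_encode (1, 0))"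
    and And: "S (prod_encode (2, prod_encode (x, z))) \<Longrightarrow> S x \<and> S z \<and>
      (\<forall>a. W a \<longrightarrow> (T a (prod_encode (2, prod_encode (x, z))) \<longleftrightarrow> T a x \<and> T a z))"
    and Or: "S (prod_encode (3, prod_encode (x, z))) \<Longrightarrow> S x \<and> S z \<and>
      (\<forall>a. W a \<longrightarrow> (T a (prod_encode (3, prod_encode (x, z))) \<longleftrightarrow> T a x \<or> T a z))"
    and Imp: "S (prod_encode (4, prod_encode (x, z))) \<Longrightarrow> S x \<and> S z \<and>
      (\<forall>a. W a \<longrightarrow> (T a (prod_encode (4, prod_encode (x, z))) \<longleftrightarrow>
        (\<forall>b. L a b \<longrightarrow> T b x \<longrightarrow> T b z)))"
    and Dia: "S (prod_encode (5, x)) \<Longrightarrow> S x \<and>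
      (\<forall>a. W a \<longrightarrow> (T a (prod_encode (5, x)) \<longleftrightarrow> (\<forall>b. L a b \<longrightarrow> (\<exists>d. R b d \<and> T d x))))"
    and Box: "S (prod_encode (6, x)) \<Longrightarrow> S x \<and>
      (\<forall>a. W a \<longrightarrow> (T a (prod_encode (6, x)) \<longleftrightarrow> (\<forall>b. L a b \<longrightarrow> (\<forall>d. R b d \<longrightarrow> T d x))))"
    and root: "S c" "\<exists>a. W a \<and> \<not> T a c"

section \<open>Meaning of the bounded formula once the bounds are dropped\<close>

lemma bounded_coded:
  "(\<forall>b<y. coded y k a b \<longrightarrow> P b) \<longleftrightarrow> (\<forall>b. coded y k a b \<longrightarrow> P b)"
  "(\<exists>b<y. coded y k a b \<and> P b) \<longleftrightarrow> (\<exists>b. coded y k a b \<and> P b)"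
  "(\<forall>a<y. coded y k a b \<longrightarrow> P a) \<longleftrightarrow> (\<forall>a. coded y k a b \<longrightarrow> P a)"
  "(\<exists>a<y. coded y k a b \<and> P a) \<longleftrightarrow> (\<exists>a. coded y k a b \<and> P a)"
  using coded_less by blast+

text \<open>Rewrite rules for a guard on \<open>a\<close> and \<open>b\<close> that stands inside
  further quantifiers or behind another guard \<open>B\<close>; the last two differ in whether the
  bound on \<open>b\<close> is still present.\<close>

lemma bounded_coded_outer:
  "(\<forall>a<y. \<forall>b. coded y k a b \<longrightarrow> P a b) \<longleftrightarrow> (\<forall>a b. coded y k a b \<longrightarrow> P a b)"
  "(\<forall>a<y. \<forall>b<y. \<forall>d. B a b d \<longrightarrow> coded y k a b \<longrightarrow> Q a b d) \<longleftrightarrow>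
    (\<forall>a b. coded y k a b \<longrightarrow> (\<forall>d. B a b d \<longrightarrow> Q a b d))"
  "(\<forall>a<y. \<forall>b d. B a b d \<longrightarrow> coded y k a b \<longrightarrow> Q a b d) \<longleftrightarrow>
    (\<forall>a b. coded y k a b \<longrightarrow> (\<forall>d. B a b d \<longrightarrow> Q a b d))"
  using coded_less by blast+

lemma bev_preorder_bf:
  fixes e :: "nat \<Rightarrow> nat" and k :: nat
  defines "C \<equiv> coded (e 0) k"
  shows "bev e (preorder_bf k) \<longleftrightarrow>
    (\<forall>a b. C a b \<longrightarrow> coded (e 0) 0 a 0 \<and> coded (e 0) 0 b 0) \<and>
    (\<forall>a. coded (e 0) 0 a 0 \<longrightarrow> C a a) \<and> (\<forall>a b d. C a b \<longrightarrow> C b d \<longrightarrow> C a d)"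
  unfolding C_def preorder_bf_def
  by (simp add: bounded_coded bounded_coded_outer)

lemma bev_confluence_bf:
  fixes e :: "nat \<Rightarrow> nat"
  defines "L \<equiv> coded (e 0) 1" and "R \<equiv> coded (e 0) 2"
  shows "bev e confluence_bf \<longleftrightarrow>
    (\<forall>a b d. L a b \<longrightarrow> R a d \<longrightarrow> (\<exists>e. L d e \<and> R b e)) \<and>
    (\<forall>a b d. R a b \<longrightarrow> L b d \<longrightarrow> (\<exists>e. L a e \<and> R e d)) \<and>
    (\<forall>a b d. L a b \<longrightarrow> R b d \<longrightarrow> (\<exists>e. R a e \<and> L e d)) \<and>
    (\<forall>a b d. L a b \<longrightarrow> L a d \<longrightarrow> L b d \<or> L d b)"
  unfolding L_def R_def confluence_bf_def
  by (simp add: bounded_coded bounded_coded_outer)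

lemma coded_unary_less: "coded y k (prod_encode (i, x)) b \<Longrightarrow> x < y"
  using coded_less(1) le_prod_encode_2 le_less_trans by blast

lemma coded_binary_less:
  assumes "coded y k (prod_encode (i, prod_encode (x, z))) b" shows "x < y" "z < y"
  using coded_unary_less[OF assms] le_prod_encode_1[of x z] le_prod_encode_2[of z x] by linarith+

lemma bev_unary_bf:
  fixes e :: "nat \<Rightarrow> nat"
  defines "S \<equiv> \<lambda>x. coded (e 0) 4 x 0"
  shows "bev e (unary_bf k f) \<longleftrightarrow> (\<forall>x. S (prod_encode (k, x)) \<longrightarrow> S x \<and>
    (\<forall>a. coded (e 0) 0 a 0 \<longrightarrow>
      (coded (e 0) 3 a (prod_encode (k, x)) \<longleftrightarrow> bev (e(3 := x, 2 := a)) f)))"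
proof -
  have "(\<forall>x<e 0. S (prod_encode (k, x)) \<longrightarrow> P x) \<longleftrightarrow> (\<forall>x. S (prod_encode (k, x)) \<longrightarrow> P x)" for P
    unfolding S_def using coded_unary_less by blast
  note b = this[unfolded S_def] bounded_coded
  show ?thesis
    unfolding S_def unary_bf_def by (simp add: b iff_conv_conj_imp[symmetric])
qed

lemma bev_binary_bf:
  fixes e :: "nat \<Rightarrow> nat"
  defines "S \<equiv> \<lambda>x. coded (e 0) 4 x 0"
  shows "bev e (binary_bf k f) \<longleftrightarrow>
    (\<forall>x z. S (prod_encode (k, prod_encode (x, z))) \<longrightarrow> S x \<and> S z \<and>
    (\<forall>a. coded (e 0) 0 a 0 \<longrightarrow>
      (coded (e 0) 3 a (prod_encode (k, prod_encode (x, z))) \<longleftrightarrow>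
        bev (e(3 := x, 4 := z, 2 := a)) f)))"
proof -
  have "(\<forall>x<e 0. \<forall>z<e 0. S (prod_encode (k, prod_encode (x, z))) \<longrightarrow> P x z) \<longleftrightarrow>
    (\<forall>x z. S (prod_encode (k, prod_encode (x, z))) \<longrightarrow> P x z)" for P
    unfolding S_def using coded_binary_less by blast
  note b = this[unfolded S_def] bounded_coded
  show ?thesis
    unfolding S_def binary_bf_def by (simp add: b iff_conv_conj_imp[symmetric] conj_left_commute)
qed

lemma bev_truth_bf:
  fixes e :: "nat \<Rightarrow> nat"
  defines "W \<equiv> \<lambda>x. coded (e 0) 0 x 0" and "L \<equiv> coded (e 0) 1" and "R \<equiv> coded (e 0) 2"
    and "T \<equiv> coded (e 0) 3" and "S \<equiv> \<lambda>x. coded (e 0) 4 x 0"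
  shows "bev e truth_bf \<longleftrightarrow>
    (\<forall>p a b. S (prod_encode (0, p)) \<longrightarrow> L a b \<longrightarrow>
      T a (prod_encode (0, p)) \<longrightarrow> T b (prod_encode (0, p))) \<and>
    (\<forall>a. S (prod_encode (1, 0)) \<longrightarrow> \<not> T a (prod_encode (1, 0))) \<and>
    (\<forall>x z. S (prod_encode (2, prod_encode (x, z))) \<longrightarrow> S x \<and> S z \<and>
      (\<forall>a. W a \<longrightarrow> (T a (prod_encode (2, prod_encode (x, z))) \<longleftrightarrow> T a x \<and> T a z))) \<and>
    (\<forall>x z. S (prod_encode (3, prod_encode (x, z))) \<longrightarrow> S x \<and> S z \<and>
      (\<forall>a. W a \<longrightarrow> (T a (prod_encode (3, prod_encode (x, z))) \<longleftrightarrow> T a x \<or> T a z))) \<and>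
    (\<forall>x z. S (prod_encode (4, prod_encode (x, z))) \<longrightarrow> S x \<and> S z \<and>
      (\<forall>a. W a \<longrightarrow> (T a (prod_encode (4, prod_encode (x, z))) \<longleftrightarrow>
        (\<forall>b. L a b \<longrightarrow> T b x \<longrightarrow> T b z)))) \<and>
    (\<forall>x. S (prod_encode (5, x)) \<longrightarrow> S x \<and>
      (\<forall>a. W a \<longrightarrow> (T a (prod_encode (5, x)) \<longleftrightarrow> (\<forall>b. L a b \<longrightarrow> (\<exists>d. R b d \<and> T d x))))) \<and>
    (\<forall>x. S (prod_encode (6, x)) \<longrightarrow> S x \<and>
      (\<forall>a. W a \<longrightarrow> (T a (prod_encode (6, x)) \<longleftrightarrow> (\<forall>b. L a b \<longrightarrow> (\<forall>d. R b d \<longrightarrow> T d x)))))"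
proof -
  have "(\<forall>p<e 0. S (prod_encode (0, p)) \<longrightarrow> P p) \<longleftrightarrow> (\<forall>p. S (prod_encode (0, p)) \<longrightarrow> P p)" for P
    unfolding S_def using coded_unary_less by blast
  note v = this[unfolded S_def]
  have "(\<forall>a<e 0. \<forall>b<e 0. L a b \<longrightarrow> P a b) \<longleftrightarrow> (\<forall>a b. L a b \<longrightarrow> P a b)" for P
    unfolding L_def using coded_less by blast
  note l = this[unfolded L_def]
  have "(\<forall>a<e 0. \<not> T a x) \<longleftrightarrow> (\<forall>a. \<not> T a x)" for x
    unfolding T_def using coded_less by blast
  note t = this[unfolded T_def]
  show ?thesis
    unfolding W_def L_def R_def T_def S_def truth_bf_def bev.simps(3) bev_binary_bf bev_unary_bf
    by (intro arg_cong2[where f = conj]) (simp_all add: v l t bounded_coded, use coded_less in blast, blast)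
qed

lemma bev_countermodel_bf:
  fixes e :: "nat \<Rightarrow> nat"
  defines "W \<equiv> \<lambda>x. coded (e 0) 0 x 0" and "L \<equiv> coded (e 0) 1" and "R \<equiv> coded (e 0) 2"
    and "T \<equiv> coded (e 0) 3" and "S \<equiv> \<lambda>x. coded (e 0) 4 x 0"
  shows "bev e countermodel_bf \<longleftrightarrow> coded_countermodel W L R T S (e 1)"
proof -
  have "bev e (BAnd (bS (TV 1)) (BEx 2 (BAnd (bW (TV 2)) (BNot (bT (TV 2) (TV 1)))))) \<longleftrightarrow>
    S (e 1) \<and> (\<exists>a. W a \<and> \<not> T a (e 1))"
    unfolding S_def W_def T_def by (simp add: bounded_coded)
  then show ?thesis
    unfolding countermodel_bf_def bev.simps(3)[of e "preorder_bf _"] bev.simps(3)[of e confluence_bf]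
      bev.simps(3)[of e truth_bf] bev_preorder_bf bev_confluence_bf bev_truth_bf coded_countermodel_def
      W_def L_def R_def T_def S_def
    by (simp only: conj_assoc)
qed

text \<open>A number meeting the conditions counts however it arose. On relevant formulas its truth
  relation must agree with satisfaction, and the relevant formulas include \<open>\<phi>\<close> and
  are closed under subformulas.\<close>

lemma coded_countermodel_sound:
  assumes "coded_countermodel W L R T S (fm_code \<phi>)"
  shows "\<phi> \<notin> GS4c"
proof -
  interpret coded_countermodel W L R T S "fm_code \<phi>" by (rule assms)
  let ?F = "\<lparr>worlds = {a. W a}, fallible = {}, le = {(a, b). L a b}, sq = {(a, b). R a b}\<rparr>"
  \<comment> \<open>Persistence of \<open>T\<close> is known for relevant variables only; all others
    are made false everywhere to obtain a valuation.\<close>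
  let ?V = "\<lambda>p. {a. W a \<and> S (prod_encode (0, p)) \<and> T a (prod_encode (0, p))}"
  have "preorder_on {a. W a} {(a, b). L a b}"
    unfolding preorder_on_def refl_on_def
    using le_W le_refl by (auto intro!: transI intro: le_trans)
  moreover have "preorder_on {a. W a} {(a, b). R a b}"
    unfolding preorder_on_def refl_on_def
    using sq_W sq_refl by (auto intro!: transI intro: sq_trans)
  ultimately have "bi_int_frame ?F"
    by (simp add: bi_int_frame_def)
  moreover have "forth_up_confluent ?F"
    unfolding forth_up_confluent_def using forth_up by simp
  moreover have "back_up_confluent ?F"
    unfolding back_up_confluent_def using back_up by simp
  moreover have "forth_down_confluent ?F"
    unfolding forth_down_confluent_def using forth_down by simp
  moreover have "upward_linear ?F"
    unfolding upward_linear_def using linear by simp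
  ultimately have F: "GS4c_frame ?F"
    by (simp add: GS4c_frame_def infallible_def)
  have V: "valuation ?F ?V"
    unfolding valuation_def using le_W Var by auto
  have truth: "sat ?F ?V a \<psi> \<longleftrightarrow> T a (fm_code \<psi>)" if "S (fm_code \<psi>)" "W a" for \<psi> a
    using that
  proof (induction \<psi> arbitrary: a)
    case (Imp \<psi> \<chi>)
    have "W b" if "L a b" for b using le_W[OF that] by simp
    then show ?case
      using Imp.IH Imp.prems(2) coded_countermodel.Imp[OF assms Imp.prems(1)[unfolded fm_code.simps]]
      by simp
  next
    case (Dia \<psi>)
    have "W d" if "R b d" for b d using sq_W[OF that] by simp
    then show ?case
      using Dia.IH Dia.prems(2) coded_countermodel.Dia[OF assms Dia.prems(1)[unfolded fm_code.simps]]
      by (simp cong: conj_cong)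
  next
    case (Box \<psi>)
    have "W d" if "R b d" for b d using sq_W[OF that] by simp
    then show ?case
      using Box.IH Box.prems(2) coded_countermodel.Box[OF assms Box.prems(1)[unfolded fm_code.simps]]
      by simp
  next
    case Bot
    then show ?case using coded_countermodel.Bot[OF assms] by simp
  next
    case (And \<psi> \<chi>)
    then show ?case
      using coded_countermodel.And[OF assms And.prems(1)[unfolded fm_code.simps]] by simp
  next
    case (Or \<psi> \<chi>)
    then show ?case
      using coded_countermodel.Or[OF assms Or.prems(1)[unfolded fm_code.simps]] by simp
  qed simp
  obtain a where "W a" "\<not> T a (fm_code \<phi>)" using root(2) by blast
  then have "falsifiable_on ?F \<phi>"
    unfolding falsifiable_on_def using V truth[OF root(1)] by auto
  then show ?thesis by (rule falsifiable_not_GS4c[OF F])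
qed

text \<open>Restricting truth to the subformulas of \<open>\<phi>\<close> keeps the structure finite
  whenever the frame is, so that it can be coded.\<close>

lemma coded_countermodel_of_frame:
  fixes F :: "nat frame"
  assumes F: "GS4c_frame F" and V: "valuation F V" and w: "w \<in> worlds F" "\<not> sat F V w \<phi>"
    and W: "\<And>a. W a \<longleftrightarrow> a \<in> worlds F" and L: "\<And>a b. L a b \<longleftrightarrow> (a, b) \<in> le F"
    and R: "\<And>a b. R a b \<longleftrightarrow> (a, b) \<in> sq F"
    and T: "\<And>a c. T a c \<longleftrightarrow> (\<exists>\<psi>\<in>subf \<phi>. c = fm_code \<psi> \<and> a \<in> worlds F \<and> sat F V a \<psi>)"
    and S: "\<And>c. S c \<longleftrightarrow> c \<in> fm_code ` subf \<phi>"
  shows "coded_countermodel W L R T S (fm_code \<phi>)"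
proof -
  note fr = GS4c_frame_simps[OF F]
  have conf: "forth_up_confluent F" "back_up_confluent F" "forth_down_confluent F" "upward_linear F"
    using F by (auto simp: GS4c_frame_def)
  \<comment> \<open>Injectivity of \<open>fm_code\<close> removes the existential quantifier over
    formulas with a given code.\<close>
  have T': "T a (fm_code \<psi>) \<longleftrightarrow> a \<in> worlds F \<and> sat F V a \<psi>" if "\<psi> \<in> subf \<phi>" for a \<psi>
    unfolding T using that inj_fm_code by (auto dest: injD)
  note sub = subf_closedD[OF subf_closed_subf[of \<phi>]]
  show ?thesis
  proof unfold_locales
    show "L a b \<Longrightarrow> W a \<and> W b" for a b using fr(4) unfolding L W by blast
    show "W a \<Longrightarrow> L a a" for a using fr(2) unfolding L W by blast
    show "L a b \<Longrightarrow> L b d \<Longrightarrow> L a d" for a b d unfolding L by (rule fr(6))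
    show "R a b \<Longrightarrow> W a \<and> W b" for a b using fr(5) unfolding R W by blast
    show "W a \<Longrightarrow> R a a" for a using fr(3) unfolding R W by blast
    show "R a b \<Longrightarrow> R b d \<Longrightarrow> R a d" for a b d unfolding R by (rule fr(7))
    show "L a b \<Longrightarrow> R a d \<Longrightarrow> \<exists>e. L d e \<and> R b e" for a b d
      using conf(1) unfolding L R forth_up_confluent_def by blast
    show "R a b \<Longrightarrow> L b d \<Longrightarrow> \<exists>e. L a e \<and> R e d" for a b d
      using conf(2) unfolding L R back_up_confluent_def by blast
    show "L a b \<Longrightarrow> R b d \<Longrightarrow> \<exists>e. R a e \<and> L e d" for a b d
      using conf(3) unfolding L R forth_down_confluent_def by blast
    show "L a b \<Longrightarrow> L a d \<Longrightarrow> L b d \<or> L d b" for a b d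
      using conf(4) unfolding L upward_linear_def by blast
    show "T b (prod_encode (0, p))"
      if "S (prod_encode (0, p))" "L a b" "T a (prod_encode (0, p))" for p a b
    proof -
      obtain \<psi> where \<psi>: "\<psi> \<in> subf \<phi>" "prod_encode (0, p) = fm_code \<psi>"
        using \<open>S _\<close> unfolding S by blast
      then show ?thesis
        using that(2,3) sat_mono[OF F V] fr(4) unfolding \<psi>(2) T'[OF \<psi>(1)] L by blast
    qed
    show "\<not> T a (prod_encode (1, 0))" if "S (prod_encode (1, 0))" for a
    proof -
      obtain \<psi> where \<psi>: "\<psi> \<in> subf \<phi>" "prod_encode (1, 0) = fm_code \<psi>"
        using \<open>S _\<close> unfolding S by blast
      then have "\<psi> = Bot" by (cases \<psi>) auto
      then show ?thesis using T'[OF \<psi>(1)] fr(1) \<psi>(2) by simp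
    qed
    show "S x \<and> S z \<and> (\<forall>a. W a \<longrightarrow> (T a (prod_encode (2, prod_encode (x, z))) \<longleftrightarrow> T a x \<and> T a z))"
      if "S (prod_encode (2, prod_encode (x, z)))" for x z
    proof -
      obtain \<psi> where \<psi>: "\<psi> \<in> subf \<phi>" "prod_encode (2, prod_encode (x, z)) = fm_code \<psi>"
        using \<open>S _\<close> unfolding S by blast
      have "\<exists>\<alpha> \<beta>. \<psi> = And \<alpha> \<beta> \<and> x = fm_code \<alpha> \<and> z = fm_code \<beta>"
        using \<psi>(2) by (cases \<psi>) simp_all
      then obtain \<alpha> \<beta> where ab: "\<psi> = And \<alpha> \<beta>" "x = fm_code \<alpha>" "z = fm_code \<beta>" by blast
      then have s: "\<alpha> \<in> subf \<phi>" "\<beta> \<in> subf \<phi>" using sub(1)[OF \<psi>(1)[unfolded ab(1)]] by auto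
      then show ?thesis
        unfolding ab(2,3) T'[OF \<psi>(1), unfolded ab(1) fm_code.simps sat.simps] T'[OF s(1)] T'[OF s(2)] W S
        by blast
    qed
    show "S x \<and> S z \<and> (\<forall>a. W a \<longrightarrow> (T a (prod_encode (3, prod_encode (x, z))) \<longleftrightarrow> T a x \<or> T a z))"
      if "S (prod_encode (3, prod_encode (x, z)))" for x z
    proof -
      obtain \<psi> where \<psi>: "\<psi> \<in> subf \<phi>" "prod_encode (3, prod_encode (x, z)) = fm_code \<psi>"
        using \<open>S _\<close> unfolding S by blast
      have "\<exists>\<alpha> \<beta>. \<psi> = Or \<alpha> \<beta> \<and> x = fm_code \<alpha> \<and> z = fm_code \<beta>"
        using \<psi>(2) by (cases \<psi>) simp_all
      then obtain \<alpha> \<beta> where ab: "\<psi> = Or \<alpha> \<beta>" "x = fm_code \<alpha>" "z = fm_code \<beta>" by blast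
      then have s: "\<alpha> \<in> subf \<phi>" "\<beta> \<in> subf \<phi>" using sub(2)[OF \<psi>(1)[unfolded ab(1)]] by auto
      then show ?thesis
        unfolding ab(2,3) T'[OF \<psi>(1), unfolded ab(1) fm_code.simps sat.simps] T'[OF s(1)] T'[OF s(2)] W S
        by blast
    qed
    show "S x \<and> S z \<and> (\<forall>a. W a \<longrightarrow> (T a (prod_encode (4, prod_encode (x, z))) \<longleftrightarrow>
        (\<forall>b. L a b \<longrightarrow> T b x \<longrightarrow> T b z)))"
      if "S (prod_encode (4, prod_encode (x, z)))" for x z
    proof -
      obtain \<psi> where \<psi>: "\<psi> \<in> subf \<phi>" "prod_encode (4, prod_encode (x, z)) = fm_code \<psi>"
        using \<open>S _\<close> unfolding S by blast
      have "\<exists>\<alpha> \<beta>. \<psi> = Imp \<alpha> \<beta> \<and> x = fm_code \<alpha> \<and> z = fm_code \<beta>"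
        using \<psi>(2) by (cases \<psi>) simp_all
      then obtain \<alpha> \<beta> where ab: "\<psi> = Imp \<alpha> \<beta>" "x = fm_code \<alpha>" "z = fm_code \<beta>" by blast
      then have s: "\<alpha> \<in> subf \<phi>" "\<beta> \<in> subf \<phi>" using sub(3)[OF \<psi>(1)[unfolded ab(1)]] by auto
      then show ?thesis
        using fr(4) unfolding ab(2,3) T'[OF \<psi>(1), unfolded ab(1) fm_code.simps sat.simps] T'[OF s(1)] T'[OF s(2)] W S L
        by blast
    qed
    show "S x \<and> (\<forall>a. W a \<longrightarrow> (T a (prod_encode (5, x)) \<longleftrightarrow> (\<forall>b. L a b \<longrightarrow> (\<exists>d. R b d \<and> T d x))))"
      if "S (prod_encode (5, x))" for x
    proof -
      obtain \<psi> where \<psi>: "\<psi> \<in> subf \<phi>" "prod_encode (5, x) = fm_code \<psi>"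
        using \<open>S _\<close> unfolding S by blast
      have "\<exists>\<alpha>. \<psi> = Dia \<alpha> \<and> x = fm_code \<alpha>"
        using \<psi>(2) by (cases \<psi>) simp_all
      then obtain \<alpha> where a: "\<psi> = Dia \<alpha>" "x = fm_code \<alpha>" by blast
      then have s: "\<alpha> \<in> subf \<phi>" using sub(4)[OF \<psi>(1)[unfolded a(1)]] by auto
      then show ?thesis
        using fr(5) unfolding a(2) T'[OF \<psi>(1), unfolded a(1) fm_code.simps sat.simps] T'[OF s] W S L R
        by blast
    qed
    show "S x \<and> (\<forall>a. W a \<longrightarrow> (T a (prod_encode (6, x)) \<longleftrightarrow>
        (\<forall>b. L a b \<longrightarrow> (\<forall>d. R b d \<longrightarrow> T d x))))"
      if "S (prod_encode (6, x))" for x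
    proof -
      obtain \<psi> where \<psi>: "\<psi> \<in> subf \<phi>" "prod_encode (6, x) = fm_code \<psi>"
        using \<open>S _\<close> unfolding S by blast
      have "\<exists>\<alpha>. \<psi> = Box \<alpha> \<and> x = fm_code \<alpha>"
        using \<psi>(2) by (cases \<psi>) simp_all
      then obtain \<alpha> where a: "\<psi> = Box \<alpha>" "x = fm_code \<alpha>" by blast
      then have s: "\<alpha> \<in> subf \<phi>" using sub(5)[OF \<psi>(1)[unfolded a(1)]] by auto
      then show ?thesis
        using fr(5) unfolding a(2) T'[OF \<psi>(1), unfolded a(1) fm_code.simps sat.simps] T'[OF s] W S L R
        by blast
    qed
    show "S (fm_code \<phi>)" unfolding S using subf_self by blast
    show "\<exists>a. W a \<and> \<not> T a (fm_code \<phi>)" unfolding W T'[OF subf_self] using w by blast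
  qed
qed

text \<open>Tags are at most 4 and both components at most \<open>world_bound c\<close>, so the
  coded set has no element above the code of the largest such triple, and its own code is below this
  power of 2.\<close>

definition code_bound :: "nat \<Rightarrow> nat" where
  "code_bound c = 2 ^ Suc (prod_encode (4, prod_encode (world_bound c, world_bound c)))"

text \<open>Lets one bound serve for worlds and for formula codes.\<close>

lemma less_world_bound: "c < world_bound c"
proof -
  have "c < 2 ^ c" by (rule less_exp)
  also have "\<dots> \<le> 2 ^ Suc c" by simp
  also have "\<dots> \<le> prod_encode (2 ^ 2 ^ Suc c, 2 ^ Suc c)" by (rule le_prod_encode_2)
  finally show ?thesis by (simp add: world_bound_def)
qed

lemma GS4c_iff_no_coded_countermodel:
  "\<phi> \<in> GS4c \<longleftrightarrow> (\<forall>y<code_bound (fm_code \<phi>). \<not> coded_countermodel (\<lambda>a. coded y 0 a 0)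
    (coded y 1) (coded y 2) (coded y 3) (\<lambda>a. coded y 4 a 0) (fm_code \<phi>))"
proof
  show "\<phi> \<in> GS4c" if h: "\<forall>y<code_bound (fm_code \<phi>). \<not> coded_countermodel (\<lambda>a. coded y 0 a 0)
    (coded y 1) (coded y 2) (coded y 3) (\<lambda>a. coded y 4 a 0) (fm_code \<phi>)"
  proof (rule ccontr)
    assume "\<phi> \<notin> GS4c"
    then obtain F :: "nat frame" where F: "GS4c_frame F" "worlds F \<subseteq> {..<world_bound (fm_code \<phi>)}"
      "falsifiable_on F \<phi>" by (rule GS4c_bounded_countermodel)
    obtain V w where V: "valuation F V" and w: "w \<in> worlds F" "\<not> sat F V w \<phi>"
      using F(3) unfolding falsifiable_on_def by blast
    define M :: "nat \<Rightarrow> nat \<Rightarrow> nat \<Rightarrow> bool" where "M k a b \<longleftrightarrow>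
      k = 0 \<and> a \<in> worlds F \<and> b = 0 \<or> k = 1 \<and> (a, b) \<in> le F \<or> k = 2 \<and> (a, b) \<in> sq F \<or>
      k = 3 \<and> (\<exists>\<psi>\<in>subf \<phi>. b = fm_code \<psi> \<and> a \<in> worlds F \<and> sat F V a \<psi>) \<or>
      k = 4 \<and> a \<in> fm_code ` subf \<phi> \<and> b = 0" for k a b
    define A where "A = {prod_encode (k, prod_encode (a, b)) |k a b. M k a b}"
    have fc: "fm_code \<psi> < world_bound (fm_code \<phi>)" if "\<psi> \<in> subf \<phi>" for \<psi>
      using fm_code_subf[OF that] less_world_bound by (rule le_less_trans)
    have "a < world_bound (fm_code \<phi>) \<and> b < world_bound (fm_code \<phi>)"
      if "(a, b) \<in> le F \<or> (a, b) \<in> sq F" for a b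
      using that F(2) GS4c_frame_simps(4,5)[OF F(1)] by blast
    then have "k \<le> 4 \<and> a \<le> world_bound (fm_code \<phi>) \<and> b \<le> world_bound (fm_code \<phi>)" if "M k a b" for k a b
      using that fc F(2) unfolding M_def by (auto intro!: less_imp_le)
    then have sub: "A \<subseteq> {..<Suc (prod_encode (4, prod_encode (world_bound (fm_code \<phi>), world_bound (fm_code \<phi>))))}"
      unfolding A_def by (auto simp: less_Suc_eq_le intro!: prod_encode_mono)
    then have "finite A" by (rule finite_subset) simp
    then have c: "coded (set_encode A) k a b \<longleftrightarrow> M k a b" for k a b
      unfolding coded_def by (simp add: A_def)
    have "set_encode A < code_bound (fm_code \<phi>)"
      unfolding code_bound_def by (rule set_encode_less[OF sub])
    moreover have "coded_countermodel (\<lambda>a. coded (set_encode A) 0 a 0) (coded (set_encode A) 1)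
      (coded (set_encode A) 2) (coded (set_encode A) 3) (\<lambda>a. coded (set_encode A) 4 a 0) (fm_code \<phi>)"
      by (rule coded_countermodel_of_frame[OF F(1) V w]) (simp_all add: c M_def)
    ultimately show False using h by blast
  qed
qed (use coded_countermodel_sound in blast)

theorem decidable_GS4c: "decidable GS4c"
proof -
  \<comment> \<open>Variable 0 is the candidate code and variable 1 the formula code; the zeros are
    placeholders for variables 2 to 6, which are all bound.\<close>
  have "recf (Suc 1) (\<lambda>xs. of_bool (\<not> bev ((!) (map (\<lambda>f. f xs)
    [\<lambda>xs. xs ! 0, \<lambda>xs. xs ! 1, \<lambda>xs. 0, \<lambda>xs. 0, \<lambda>xs. 0, \<lambda>xs. 0, \<lambda>xs. 0])) countermodel_bf))"
    by (rule recf_comp, rule recf_not, rule recf_bev)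
      (use bwf_countermodel_bf in \<open>auto simp: eval_nat_numeral intro!: recf_nth recf_const\<close>)
  then have "recf (Suc 1) (\<lambda>xs. of_bool (\<not> bev ((!) [hd xs, tl xs ! 0, 0, 0, 0, 0, 0]) countermodel_bf))"
    by (rule recf_cong) (auto simp: length_Suc_conv)
  then have "recf 1 (\<lambda>xs. of_bool (\<forall>y<code_bound (xs ! 0).
      \<not> bev ((!) [y, xs ! 0, 0, 0, 0, 0, 0]) countermodel_bf))"
    by (rule recf_ball) (unfold code_bound_def world_bound_def,
      intro recf_power2 recf_Suc recf_prod_encode recf_const recf_nth, simp_all)
  then obtain f where f: "recursive_fun 1 f" "\<And>xs. length xs = 1 \<Longrightarrow>
      f xs = of_bool (\<forall>y<code_bound (xs ! 0). \<not> bev ((!) [y, xs ! 0, 0, 0, 0, 0, 0]) countermodel_bf)"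
    unfolding recf_def by blast
  have "f [fm_code \<phi>] = (if \<phi> \<in> GS4c then 1 else 0)" for \<phi>
    unfolding GS4c_iff_no_coded_countermodel f(2)[of "[fm_code \<phi>]", simplified] bev_countermodel_bf
    by (simp add: of_bool_def)
  then show ?thesis unfolding decidable_def using f(1) by blast
qed

text \<open>\<open>F\<close> enters only through soundness, which shows that \<open>\<phi>\<close>
  is not a theorem; completeness with the bounded quotient then supplies the finite frame.\<close>

lemma GS4c_finite_falsifiable:
  fixes F :: "'w frame"
  assumes "GS4c_frame F" "falsifiable_on F \<phi>"
  shows "\<exists>F :: nat frame. GS4c_frame F \<and> finite (worlds F) \<and> falsifiable_on F \<phi>"
proof -
  obtain G :: "nat frame" where "GS4c_frame G" "worlds G \<subseteq> {..<world_bound (fm_code \<phi>)}"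
    "falsifiable_on G \<phi>"
    using GS4c_bounded_countermodel[OF falsifiable_not_GS4c[OF assms]] by blast
  then show ?thesis using finite_subset[OF _ finite_lessThan] by blast
qed

theorem mainTheorem3:
  shows "(\<forall>\<phi>.
      ((\<exists>F :: 'w frame. GS4c_frame F \<and> falsifiable_on F \<phi>) \<longrightarrow>
        (\<exists>F :: nat frame. GS4c_frame F \<and> finite (worlds F) \<and> falsifiable_on F \<phi>)) \<and>
      ((\<exists>F :: 'w frame. GS4c_frame F \<and> satisfiable_on F \<phi>) \<longrightarrow>
        (\<exists>F :: nat frame. GS4c_frame F \<and> finite (worlds F) \<and> satisfiable_on F \<phi>)))
    \<and> decidable GS4c"
proof (intro conjI allI impI)
  fix \<phi>
  show "\<exists>F :: nat frame. GS4c_frame F \<and> finite (worlds F) \<and> falsifiable_on F \<phi>"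
    if "\<exists>F :: 'w frame. GS4c_frame F \<and> falsifiable_on F \<phi>"
    using that GS4c_finite_falsifiable by blast
  show "\<exists>F :: nat frame. GS4c_frame F \<and> finite (worlds F) \<and> satisfiable_on F \<phi>"
    if "\<exists>F :: 'w frame. GS4c_frame F \<and> satisfiable_on F \<phi>"
    using that GS4c_finite_falsifiable[of _ "\<^bold>\<not> \<phi>"] satisfiable_iff_falsifiable_Neg by metis
qed (rule decidable_GS4c)

end
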